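(* Let $d\in(0,1/2)$ and let the bivariate series $\{Y_n\}_{n\in\mathbb{Z}}$ be given by $$Y_n=\sum_{l=-\infty}^\infty A_l\varepsilon_{n-l},\qquad A_l=\begin{pmatrix} a_{0,l} & a_{1,l} \\ -a_{1,l} & a_{0,l} \end{pmatrix}\in\mathbb{R}^{2\times2},$$ where $\{\varepsilon_n\}$ is a bivariate white noise with $\mathbb{E}\varepsilon_n\varepsilon_n^T=I_2$ and, for some $a_0,a_1\in\mathbb{R}$, $$A_l\sim A^+\,l^{d-1}\ (l\to+\infty),\qquad A_l\sim A^-\,(-l)^{d-1}\ (l\to-\infty),\qquad A^+=\begin{pmatrix} a_0 & a_1 \\ -a_1 & a_0 \end{pmatrix}=(A^-)^T.$$ Let the limiting form of the autocovariance function $\gamma_Y(h)=\mathbb{E}Y_{n+h}Y_n^T$ be $$\gamma_Y(h)\sim\begin{pmatrix} r_0 & -r_1 \\ r_1 & r_0 \end{pmatrix}h^{2d-1},\quad h\to\infty,$$ and the limiting form of the spectral density matrix $f_Y$ be $$f_Y(\lambda)\sim\begin{pmatrix} g_0 & ig_1 \\ -ig_1 & g_0 \end{pmatrix}\lambda^{-2d},\quad\lambda\to0^+.$$ Then $$r_0=\frac{\Gamma^2(d)}{\Gamma(2d)}\left[(a_0^2+a_1^2)\frac{1}{\cos(\pi d)}+(a_0^2-a_1^2)\right],\qquad r_1=-2a_0a_1\frac{\Gamma^2(d)}{\Gamma(2d)},$$ and $$g_0=\frac{\Gamma(2d)}{\pi}\cos(\pi d)\,r_0,\qquad g_1=\frac{\Gamma(2d)}{\pi}\sin(\pi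 d)\,r_1.$$
   Context: White noise: $\mathbb{E}\varepsilon_n=0$, $\mathbb{E}\varepsilon_n\varepsilon_m^T=0$ for $n\neq m$, $\mathbb{E}\varepsilon_n\varepsilon_n^T=I_2$. The spectral density convention is $f_Y(\lambda)=\frac{1}{2\pi}\sum_{h=-\infty}^\infty e^{-ih\lambda}\gamma_Y(h)$, $\gamma_Y(h)=\int_{-\pi}^{\pi}e^{ih\lambda}f_Y(\lambda)\,d\lambda$. All matrix relations $\sim$ are entrywise, with $M(x)\sim C\,\rho(x)$ meaning $M_{jk}(x)=C_{jk}\rho(x)+o(\rho(x))$ (so a zero coefficient means $o(\rho(x))$). Here $r_0,r_1,g_0,g_1\in\mathbb{R}$. *)

theory Defs
  imports "HOL-Probability.Probability"
begin

abbreviation mat22 :: "'a::zero \<Rightarrow> 'a \<Rightarrow> 'a \<Rightarrow> 'a \<Rightarrow> 'a^2^2" where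
  "mat22 a b c e \<equiv> vector [vector [a, b], vector [c, e]]"

(* Entrywise M(x) ~ C rho(x) along F, a zero entry of C meaning o(rho(x)). *)
definition mat_asymp ::
  "'x filter \<Rightarrow> ('x \<Rightarrow> 'a::real_normed_field^'n^'m) \<Rightarrow> 'a^'n^'m \<Rightarrow> ('x \<Rightarrow> real) \<Rightarrow> bool" where
  "mat_asymp F M C \<rho> \<longleftrightarrow>
    (\<forall>j k. (\<lambda>x. M x $ j $ k - C $ j $ k * of_real (\<rho> x)) \<in> o[F](\<lambda>x. of_real (\<rho> x)))"

definition square_integrable :: "'w measure \<Rightarrow> ('w \<Rightarrow> real^'n) \<Rightarrow> bool" where
  "square_integrable M X \<longleftrightarrow>
    X \<in> borel_measurable M \<and> integrable M (\<lambda>\<omega>. (norm (X \<omega>))\<^sup>2)"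

(* The matrix E[X Z^T]. *)
definition cross_moment ::
  "'w measure \<Rightarrow> ('w \<Rightarrow> real^'m) \<Rightarrow> ('w \<Rightarrow> real^'n) \<Rightarrow> real^'n^'m" where
  "cross_moment M X Z = (\<chi> j k. \<integral>\<omega>. X \<omega> $ j * Z \<omega> $ k \<partial>M)"

definition white_noise :: "'w measure \<Rightarrow> (int \<Rightarrow> 'w \<Rightarrow> real^'n) \<Rightarrow> bool" where
  "white_noise M \<epsilon> \<longleftrightarrow>
    (\<forall>n. square_integrable M (\<epsilon> n)) \<and>
    (\<forall>n. (\<integral>\<omega>. \<epsilon> n \<omega> \<partial>M) = 0) \<and>
    (\<forall>n m. n \<noteq> m \<longrightarrow> cross_moment M (\<epsilon> n) (\<epsilon> m) = 0) \<and>
    (\<forall>n. cross_moment M (\<epsilon> n) (\<epsilon> n) = mat 1)"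

(* The two-sided series is understood in mean square, both ends tending to infinity independently. *)
definition linear_process ::
  "'w measure \<Rightarrow> (int \<Rightarrow> real^'n^'m) \<Rightarrow> (int \<Rightarrow> 'w \<Rightarrow> real^'n) \<Rightarrow> (int \<Rightarrow> 'w \<Rightarrow> real^'m) \<Rightarrow> bool"
  where
  "linear_process M A \<epsilon> Y \<longleftrightarrow>
    (\<forall>n. square_integrable M (Y n) \<and>
      ((\<lambda>(p, q). \<integral>\<omega>. (norm (Y n \<omega> - (\<Sum>l = -p..q. A l *v \<epsilon> (n - l) \<omega>)))\<^sup>2 \<partial>M)
        \<longlongrightarrow> 0) (at_top \<times>\<^sub>F at_top))"

(* Meaningful for second-order stationary Y, where E[Y(n+h) Y(n)^T] does not depend on n. *)
definition autocov ::
  "'w measure \<Rightarrow> (int \<Rightarrow> 'w \<Rightarrow> real^'n) \<Rightarrow> int \<Rightarrow> real^'n^'n" where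
  "autocov M Y h = (THE G. \<forall>n. G = cross_moment M (Y (n + h)) (Y n))"

(* The normalisation is that of f(x) = (1 / 2pi) sum_h e^(-ihx) gamma(h).  That series need not
   converge pointwise when gamma is not absolutely summable, so a spectral density is
   characterised by the inverse relation; it is determined up to null sets only. *)
definition is_spectral_density :: "(int \<Rightarrow> real^'n^'n) \<Rightarrow> (real \<Rightarrow> complex^'n^'n) \<Rightarrow> bool" where
  "is_spectral_density \<gamma> f \<longleftrightarrow>
    (\<forall>j k. (\<lambda>x. f x $ j $ k) absolutely_integrable_on {-pi..pi}) \<and>
    (\<forall>h j k. ((\<lambda>x. exp (\<i> * of_int h * of_real x) * f x $ j $ k)
       has_integral of_real (\<gamma> h $ j $ k)) {-pi..pi})"

end

(* With s = 2 d.  Mean-square convergence gives gamma(h) = sum_l A_(l+h) A_l^T, a lattice sum that is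
   an integral of step functions; after rescaling by h it converges by domination to an integral of
   |x+1|^(d-1) |x|^(d-1).  The pieces x > 0 and x < -1 contribute B(d,1-2d) each and -1 < x < 0
   contributes B(d,d), and the reflection formula gives 2 B(d,1-2d) = Gamma(d)^2 / (Gamma(2d) cos(pi d)).

   For the spectral density, the Abel sum of exp(-h/n) gamma(h) over h >= 1 is computed twice.  As a
   Riemann sum it is asymptotic to n^s b Gamma(s) when gamma(h) ~ b h^(s-1).  As an integral it
   is that of q/(1-q) f(x) over [-pi,pi] with q = exp(-1/n + ix); because gamma is real this is twice the real
   part of the integral over (0,pi), and the substitution x = t/n shows that it is asymptotic to
   n^s 2 Re(c I) when f(x) ~ c x^(-s), where
   I = int_0^oo t^(-s)/(1-it) dt = (pi/2) (1/cos(pi s/2) + i/sin(pi s/2)). *)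

theory Submission
  imports Defs
begin

text \<open>The decay exponent of gamma exceeds -1, so gamma need not be summable and its power law
  cannot be carried through the Fourier series termwise. The damping exp(-h/n) makes every exchange
  of sum and integral absolutely convergent. As both power laws are given, only constants are
  compared, by an Abelian limit on each side.

  The obstacle is that f is controlled only to the right of 0, while the Fourier integral runs over
  both sides. The two sides are linked only by the coefficients, and these fix f only up to null
  sets. The symmetry is therefore obtained in integrated form: V(x) - cnj V(-x) has vanishing
  coefficients, so it is annihilated by trigonometric polynomials, then by continuous functions on
  the circle (Stone-Weierstrass), then by continuous functions cut off to the lower half circle. The
  last class contains the cut-off Abel kernel.

  In the time domain the scalar sequences on the diagonal and off it are asymptotically even and
  odd, because the two limit matrices are transposes. This parity decides which Beta values survive
  in r0 and r1.\<close>

section \<open>Lattice sums of regularly varying sequences\<close>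

text \<open>Each fibre of \<open>floor\<close> is a half-open interval of length one. Sums over the
  integers thus become integrals against one fixed measure, so that after rescaling the step
  functions for different n can be compared by dominated convergence.\<close>

lemma distr_lborel_floor: "distr lborel (count_space UNIV) (floor :: real \<Rightarrow> int) = count_space UNIV"
proof (rule measure_eqI_countable[of _ UNIV])
  fix i :: int assume "i \<in> UNIV"
  have "(floor :: real \<Rightarrow> int) -` {i} = {of_int i..<of_int i + 1}"
    by (auto simp: floor_eq_iff)
  then show "emeasure (distr lborel (count_space UNIV) (floor :: real \<Rightarrow> int)) {i} = emeasure (count_space UNIV) {i}"
    by (subst emeasure_distr) auto
qed auto

lemma lborel_integrable_floor_iff:
  fixes f :: "int \<Rightarrow> 'a :: {banach, second_countable_topology}"
  shows "integrable lborel (\<lambda>x::real. f \<lfloor>x\<rfloor>) \<longleftrightarrow> integrable (count_space UNIV) f"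
  using integrable_distr_eq[of "floor :: real \<Rightarrow> int" lborel "count_space UNIV" f]
  by (simp add: distr_lborel_floor)

lemma lborel_integral_floor:
  fixes f :: "int \<Rightarrow> 'a :: {banach, second_countable_topology}"
  shows "(\<integral>x. f \<lfloor>x::real\<rfloor> \<partial>lborel) = (\<integral>l. f l \<partial>count_space UNIV)"
  using integral_distr[of "floor :: real \<Rightarrow> int" lborel "count_space UNIV" f]
  by (simp add: distr_lborel_floor)

lemma lattice_sum_scaled:
  fixes f :: "int \<Rightarrow> real" and h :: real
  assumes "h > 0"
  shows "(\<integral>l. f l \<partial>count_space UNIV) = h * (\<integral>x. f \<lfloor>h * x\<rfloor> \<partial>lborel)"
  using lborel_integral_real_affine[of h "\<lambda>x. f \<lfloor>x\<rfloor>" 0] assms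
  by (simp add: lborel_integral_floor)

lemma integrable_lattice_scaled_iff:
  fixes f :: "int \<Rightarrow> real" and h :: real
  assumes "h > 0"
  shows "integrable lborel (\<lambda>x. f \<lfloor>h * x\<rfloor>) \<longleftrightarrow> integrable (count_space UNIV) f"
  using lborel_integrable_real_affine_iff[of h "\<lambda>x. f \<lfloor>x\<rfloor>" 0] assms
  by (simp add: lborel_integrable_floor_iff)

text \<open>Write n^(-s) a(k) as a(k) / k^s times (k/n)^s. Positivity of \<open>y\<close> forces
  \<open>k n\<close> to infinity, so the first factor tends to \<open>c\<close> along it, and it
  keeps the power function continuous at the limit of the second.\<close>

lemma scaled_power_tendsto:
  fixes a :: "int \<Rightarrow> real" and k :: "nat \<Rightarrow> int"
  assumes a: "((\<lambda>l. a l / of_int l powr s) \<longlongrightarrow> c) at_top"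
    and k: "(\<lambda>n. of_int (k n) / real n) \<longlonglongrightarrow> y" and y: "y > 0"
  shows "(\<lambda>n. real n powr (- s) * a (k n)) \<longlonglongrightarrow> c * y powr s"
proof -
  have "filterlim (\<lambda>n. of_int (k n) / real n * real n) at_top sequentially"
    by (rule filterlim_tendsto_pos_mult_at_top[OF k y filterlim_real_sequentially])
  moreover have "\<forall>\<^sub>F n in sequentially. of_int (k n) / real n * real n = of_int (k n)"
    using eventually_gt_at_top[of 0] by eventually_elim auto
  ultimately have kinf: "filterlim (\<lambda>n. real_of_int (k n)) at_top sequentially"
    by (simp cong: filterlim_cong)
  have kint: "filterlim k at_top sequentially"
    unfolding filterlim_at_top
  proof
    fix Z
    have "\<forall>\<^sub>F n in sequentially. real_of_int Z \<le> real_of_int (k n)"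
      using kinf unfolding filterlim_at_top by blast
    then show "\<forall>\<^sub>F n in sequentially. Z \<le> k n" by eventually_elim simp
  qed
  have "(\<lambda>n. a (k n) / of_int (k n) powr s * (of_int (k n) / real n) powr s) \<longlonglongrightarrow> c * y powr s"
    by (intro tendsto_mult filterlim_compose[OF a kint] tendsto_powr k tendsto_const) (use y in auto)
  moreover have "\<forall>\<^sub>F n in sequentially. a (k n) / of_int (k n) powr s * (of_int (k n) / real n) powr s
      = real n powr (- s) * a (k n)"
  proof -
    have "\<forall>\<^sub>F n in sequentially. k n \<ge> 1" using kint by (auto simp: filterlim_at_top)
    then show ?thesis
      by eventually_elim (simp add: powr_divide powr_minus field_simps)
  qed
  ultimately show ?thesis by (rule Lim_transform_eventually)
qed

lemma floor_scaled_tendsto: "(\<lambda>n. of_int \<lfloor>real n * x\<rfloor> / real n) \<longlonglongrightarrow> x"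
proof -
  have *: "(\<lambda>n. x - 1 / real n) \<longlonglongrightarrow> x"
    using tendsto_diff[OF tendsto_const lim_inverse_n', of x] by simp
  show ?thesis
  proof (rule tendsto_sandwich[OF _ _ * tendsto_const])
    show "\<forall>\<^sub>F n in sequentially. x - 1 / real n \<le> of_int \<lfloor>real n * x\<rfloor> / real n"
      using eventually_gt_at_top[of 0]
    proof eventually_elim
      case (elim n)
      have "real n * x - 1 \<le> of_int \<lfloor>real n * x\<rfloor>" by linarith
      then have "(real n * x - 1) / n \<le> of_int \<lfloor>real n * x\<rfloor> / n" by (rule divide_right_mono) auto
      then show ?case using elim by (simp add: diff_divide_distrib)
    qed
    show "\<forall>\<^sub>F n in sequentially. of_int \<lfloor>real n * x\<rfloor> / real n \<le> x"
      using eventually_gt_at_top[of 0]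
    proof eventually_elim
      case (elim n)
      have "of_int \<lfloor>real n * x\<rfloor> \<le> real n * x" by linarith
      then have "of_int \<lfloor>real n * x\<rfloor> / n \<le> (real n * x) / n" by (rule divide_right_mono) auto
      then show ?case using elim by simp
    qed
  qed
qed

text \<open>Stated with quotients so that \<open>p\<close> or \<open>m\<close> may vanish, which
  then means o(l^s) on that side. Both sides are measured against the power of the absolute value of
  the index.\<close>

definition two_sided_power :: "real \<Rightarrow> (int \<Rightarrow> real) \<Rightarrow> real \<Rightarrow> real \<Rightarrow> bool" where
  "two_sided_power s a p m \<longleftrightarrow>
    ((\<lambda>l. a l / of_int l powr s) \<longlongrightarrow> p) at_top \<and>
    ((\<lambda>l. a (- l) / of_int l powr s) \<longlongrightarrow> m) at_top"

lemma two_sided_power_scaled: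
  assumes "two_sided_power s a p m" "x \<noteq> 0"
  shows "(\<lambda>n. real n powr (- s) * a \<lfloor>real n * x\<rfloor>) \<longlonglongrightarrow> (if x > 0 then p else m) * \<bar>x\<bar> powr s"
proof (cases "x > 0")
  case True
  then show ?thesis
    using scaled_power_tendsto[OF _ floor_scaled_tendsto[of x], of a s p] assms
    by (simp add: two_sided_power_def)
next
  case False
  have "(\<lambda>n. of_int (- \<lfloor>real n * x\<rfloor>) / real n) \<longlonglongrightarrow> - x"
    using tendsto_minus[OF floor_scaled_tendsto[of x]] by simp
  from scaled_power_tendsto[OF _ this, of "\<lambda>l. a (- l)" s m] False assms
  show ?thesis by (simp add: two_sided_power_def)
qed

text \<open>Finitely many initial terms are absorbed in a maximum. Beyond them l + 1 \<le> 2 l and s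
  \<le> 0 replace l^s by (l+1)^s at the cost of the factor 2^(-s). The shift by one keeps the bound
  meaningful at l = 0, where \<open>0 powr s\<close> is 0.\<close>

lemma power_bound_at_top:
  fixes a :: "int \<Rightarrow> real"
  assumes a: "((\<lambda>l. a l / of_int l powr s) \<longlongrightarrow> p) at_top" and s: "s \<le> 0"
  obtains C where "C > 0" "\<And>l. l \<ge> 0 \<Longrightarrow> \<bar>a l\<bar> \<le> C * (of_int l + 1) powr s"
proof -
  have "\<forall>\<^sub>F l in at_top. dist (a l / of_int l powr s) p < 1"
    using a by (rule tendstoD) simp
  then obtain N where N: "\<And>l. l \<ge> N \<Longrightarrow> dist (a l / of_int l powr s) p < 1"
    by (auto simp: eventually_at_top_linorder)
  define N1 where "N1 = max N 1"
  define D where "D = Max ((\<lambda>l. \<bar>a l\<bar> / (of_int l + 1) powr s) ` {0..N1})"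
  define C where "C = max D ((\<bar>p\<bar> + 1) * 2 powr (- s))"
  have "C > 0" unfolding C_def by (simp add: less_max_iff_disj)
  moreover have "\<bar>a l\<bar> \<le> C * (of_int l + 1) powr s" if l: "l \<ge> 0" for l
  proof (cases "l \<le> N1")
    case True
    have "\<bar>a l\<bar> / (of_int l + 1) powr s \<le> D" unfolding D_def
      by (intro Max_ge) (use True l in auto)
    also have "\<dots> \<le> C" by (simp add: C_def)
    finally show ?thesis using l by (simp add: divide_le_eq)
  next
    case False
    then have l1: "l \<ge> 1" "l \<ge> N" by (auto simp: N1_def)
    then have lp: "of_int l powr s > (0::real)" by simp
    have "\<bar>a l / of_int l powr s\<bar> \<le> \<bar>p\<bar> + 1"
      using N[OF l1(2)] unfolding dist_real_def by linarith
    then have 1: "\<bar>a l\<bar> \<le> (\<bar>p\<bar> + 1) * of_int l powr s"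
      using lp by (simp add: abs_divide divide_le_eq)
    have "(2 * of_int l) powr s \<le> (of_int l + 1 :: real) powr s"
      by (rule powr_mono2') (use l1 s in auto)
    then have "of_int l powr s \<le> 2 powr (- s) * (of_int l + 1 :: real) powr s"
      using l1 by (simp add: powr_mult powr_minus field_simps)
    then have "(\<bar>p\<bar> + 1) * of_int l powr s \<le> (\<bar>p\<bar> + 1) * (2 powr (- s) * (of_int l + 1 :: real) powr s)"
      by (rule mult_left_mono) auto
    also have "\<dots> \<le> C * (of_int l + 1 :: real) powr s"
      unfolding mult.assoc[symmetric] by (rule mult_right_mono) (auto simp: C_def)
    finally show ?thesis using 1 by linarith
  qed
  ultimately show thesis by (rule that)
qed

lemma two_sided_power_bound:
  assumes "two_sided_power s a p m" "s \<le> 0"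
  obtains C where "C > 0" "\<And>l. \<bar>a l\<bar> \<le> C * (of_int \<bar>l\<bar> + 1) powr s"
proof -
  obtain C1 where C1: "C1 > 0" "\<And>l. l \<ge> 0 \<Longrightarrow> \<bar>a l\<bar> \<le> C1 * (of_int l + 1) powr s"
    using power_bound_at_top assms unfolding two_sided_power_def by blast
  obtain C2 where C2: "C2 > 0" "\<And>l. l \<ge> 0 \<Longrightarrow> \<bar>a (- l)\<bar> \<le> C2 * (of_int l + 1) powr s"
    using power_bound_at_top[of "\<lambda>l. a (- l)"] assms unfolding two_sided_power_def by blast
  have "\<bar>a l\<bar> \<le> (C1 + C2) * (of_int \<bar>l\<bar> + 1) powr s" for l
  proof (cases "l \<ge> 0")
    case True
    have "C1 * (of_int l + 1) powr s \<le> (C1 + C2) * (of_int l + 1) powr s"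
      by (rule mult_right_mono) (use C2 in auto)
    with C1(2)[OF True] have "\<bar>a l\<bar> \<le> (C1 + C2) * (of_int l + 1) powr s" by linarith
    then show ?thesis using True by simp
  next
    case False
    have "C2 * (of_int (- l) + 1) powr s \<le> (C1 + C2) * (of_int (- l) + 1) powr s"
      by (rule mult_right_mono) (use C1 in auto)
    moreover have "\<bar>a l\<bar> \<le> C2 * (of_int (- l) + 1) powr s" using C2(2)[of "- l"] False by simp
    ultimately have "\<bar>a l\<bar> \<le> (C1 + C2) * (of_int (- l) + 1) powr s" by linarith
    then show ?thesis using False by simp
  qed
  then show thesis using that[of "C1 + C2"] C1 C2 by auto
qed

text \<open>Since n |x| is at most the absolute value of its rounded argument plus one, and the
  exponent is not positive, the bound with the shifted index gives a majorant that does not depend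
  on n.\<close>

lemma two_sided_power_scaled_bound:
  assumes C: "\<And>l. \<bar>a l\<bar> \<le> C * (of_int \<bar>l\<bar> + 1) powr s" "C > 0" and "s \<le> 0" "n > 0" "x \<noteq> 0"
  shows "\<bar>real n powr (- s) * a \<lfloor>real n * x\<rfloor>\<bar> \<le> C * \<bar>x\<bar> powr s"
proof -
  have "real n * \<bar>x\<bar> \<le> of_int \<bar>\<lfloor>real n * x\<rfloor>\<bar> + 1"
  proof -
    have "real n * \<bar>x\<bar> = \<bar>real n * x\<bar>" by (simp add: abs_mult)
    then show ?thesis by linarith
  qed
  then have "(of_int \<bar>\<lfloor>real n * x\<rfloor>\<bar> + 1) powr s \<le> (real n * \<bar>x\<bar>) powr s"
    by (intro powr_mono2') (use assms in auto)
  then have "C * (of_int \<bar>\<lfloor>real n * x\<rfloor>\<bar> + 1) powr s \<le> C * (real n * \<bar>x\<bar>) powr s"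
    using C by simp
  then have "\<bar>a \<lfloor>real n * x\<rfloor>\<bar> \<le> C * (real n * \<bar>x\<bar>) powr s"
    using C(1)[of "\<lfloor>real n * x\<rfloor>"] by linarith
  then show ?thesis using assms by (simp add: abs_mult powr_mult powr_minus field_simps)
qed

section \<open>Beta and Mellin integrals\<close>

lemma set_integrable_lborel_iff_absolutely_integrable:
  fixes f :: "real \<Rightarrow> 'a :: euclidean_space"
  assumes "S \<in> sets borel" "f \<in> borel_measurable borel"
  shows "set_integrable lborel S f \<longleftrightarrow> f absolutely_integrable_on S"
  unfolding set_integrable_def
  by (rule integrable_completion[symmetric]) (use assms in measurable)

lemma beta_integral_open_interval:
  fixes a b :: real
  assumes "a > 0" "b > 0"
  shows "set_integrable lborel {0<..<1} (\<lambda>t. t powr (a - 1) * (1 - t) powr (b - 1))"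
    and "(LINT t:{0<..<1}|lborel. t powr (a - 1) * (1 - t) powr (b - 1)) = Beta a b"
proof -
  have hi: "((\<lambda>t. t powr (a - 1) * (1 - t) powr (b - 1)) has_integral Beta a b) {0<..<1}"
    using has_integral_Beta_real[OF assms] by (simp add: has_integral_Icc_iff_Ioo)
  then have "(\<lambda>t. t powr (a - 1) * (1 - t) powr (b - 1)) absolutely_integrable_on {0<..<1}"
    by (intro nonnegative_absolutely_integrable_1) auto
  then show *: "set_integrable lborel {0<..<1} (\<lambda>t. t powr (a - 1) * (1 - t) powr (b - 1))"
    by (subst set_integrable_lborel_iff_absolutely_integrable) auto
  show "(LINT t:{0<..<1}|lborel. t powr (a - 1) * (1 - t) powr (b - 1)) = Beta a b"
    using set_borel_integral_eq_integral(2)[OF *] hi by (simp add: integral_unique)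
qed

text \<open>The substitution x = t / (1 - t) carries (0,1) onto the half line. There 1 + x = 1 / (1
  - t), so all factors become powers of t and 1 - t.\<close>

lemma beta_integral_half_line:
  fixes a b :: real
  assumes "a > 0" "b > 0"
  shows "set_integrable lborel {0<..} (\<lambda>x. x powr (a - 1) * (1 + x) powr (- a - b))"
    and "(LINT x:{0<..}|lborel. x powr (a - 1) * (1 + x) powr (- a - b)) = Beta a b"
proof -
  let ?g = "\<lambda>t::real. t / (1 - t)"
  let ?f = "\<lambda>x::real. x powr (a - 1) * (1 + x) powr (- a - b)"
  have eq: "\<bar>1 / (1 - t)^2\<bar> * ?f (?g t) = t powr (a - 1) * (1 - t) powr (b - 1)"
    if "t \<in> {0<..<1}" for t
  proof -
    have "1 + ?g t = 1 / (1 - t)" using that by (simp add: field_simps)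
    moreover have "\<bar>1 / (1 - t)^2\<bar> = (1 - t) powr (- 2)"
      using that by (simp add: powr_minus powr_numeral field_simps)
    moreover have "?g t powr (a - 1) = t powr (a - 1) * (1 - t) powr (- (a - 1))"
      using that powr_minus_divide[of "1 - t" "a - 1"] by (simp add: powr_divide)
    moreover have "(1 / (1 - t)) powr (- a - b) = (1 - t) powr (a + b)"
      using that powr_minus_divide[of "1 - t" "a + b"] by (simp add: powr_divide)
    ultimately have "\<bar>1 / (1 - t)^2\<bar> * ?f (?g t)
        = t powr (a - 1) * ((1 - t) powr (-2) * (1 - t) powr (- (a - 1)) * (1 - t) powr (a + b))"
      by (simp only: mult_ac)
    also have "(1 - t) powr (-2) * (1 - t) powr (- (a - 1)) * (1 - t) powr (a + b) = (1 - t) powr (b - 1)"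
      by (simp flip: powr_add)
    finally show ?thesis .
  qed
  have img: "?g ` {0<..<1} = {0<..}"
  proof (intro equalityI subsetI)
    fix x :: real assume "x \<in> {0<..}"
    then have "x = ?g (x / (1 + x))" "x / (1 + x) \<in> {0<..<1}" by (auto simp: field_simps)
    then show "x \<in> ?g ` {0<..<1}" by blast
  qed auto
  have "(\<lambda>t. \<bar>1 / (1 - t)^2\<bar> * ?f (?g t)) absolutely_integrable_on {0<..<1} \<and>
        integral {0<..<1} (\<lambda>t. \<bar>1 / (1 - t)^2\<bar> * ?f (?g t)) = Beta a b"
  proof
    have *: "set_integrable lborel {0<..<1} (\<lambda>t. t powr (a - 1) * (1 - t) powr (b - 1))"
      by (rule beta_integral_open_interval[OF assms])
    have "(\<lambda>t. t powr (a - 1) * (1 - t) powr (b - 1)) absolutely_integrable_on {0<..<1}"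
      using * by (subst (asm) set_integrable_lborel_iff_absolutely_integrable) auto
    then show "(\<lambda>t. \<bar>1 / (1 - t)^2\<bar> * ?f (?g t)) absolutely_integrable_on {0<..<1}"
      by (subst set_integrable_cong[OF refl refl eq]) auto
    have "integral {0<..<1} (\<lambda>t. t powr (a - 1) * (1 - t) powr (b - 1)) = Beta a b"
      using beta_integral_open_interval(2)[OF assms] set_borel_integral_eq_integral(2)[OF *] by simp
    then show "integral {0<..<1} (\<lambda>t. \<bar>1 / (1 - t)^2\<bar> * ?f (?g t)) = Beta a b"
      by (subst integral_cong[OF eq]) auto
  qed
  moreover have "(?g has_field_derivative 1 / (1 - t)^2) (at t within {0<..<1})" if "t \<in> {0<..<1}" for t
    using that by (auto intro!: derivative_eq_intros simp: field_simps power2_eq_square)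
  moreover have "inj_on ?g {0<..<1}"
    by (auto simp: inj_on_def field_simps)
  ultimately have "?f absolutely_integrable_on {0<..} \<and> integral {0<..} ?f = Beta a b"
    using has_absolute_integral_change_of_variables_1'[of "{0<..<1}" ?g "\<lambda>t. 1 / (1 - t)^2" ?f "Beta a b"]
    unfolding img by auto
  then have int: "?f absolutely_integrable_on {0<..}" "integral {0<..} ?f = Beta a b" by auto
  show *: "set_integrable lborel {0<..} ?f"
    by (subst set_integrable_lborel_iff_absolutely_integrable) (use int in auto)
  show "(LINT x:{0<..}|lborel. ?f x) = Beta a b"
    using set_borel_integral_eq_integral(2)[OF *] int by simp
qed

lemma Gamma_reflection_real: "Gamma x * Gamma (1 - x) = pi / sin (pi * (x :: real))"
proof -
  have "complex_of_real (Gamma x * Gamma (1 - x)) = of_real (pi / sin (pi * x))"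
  proof -
    have "Gamma (complex_of_real (1 - x)) = of_real (Gamma (1 - x))"
      by (rule Gamma_complex_of_real)
    moreover have "sin (complex_of_real (pi * x)) = of_real (sin (pi * x))"
      by (rule sin_of_real)
    ultimately show ?thesis
      using Gamma_reflection_complex[of "of_real x"] by (simp add: Gamma_complex_of_real)
  qed
  then show ?thesis by (simp only: of_real_eq_iff)
qed

text \<open>With y = x^2 and a = (c + 1) / 2 this is half the integral of y^(a-1) / (1 + y), that is
  Beta(a, 1-a) = Gamma(a) Gamma(1-a). The reflection formula applies, and sin(pi a) = cos(pi c /
  2).\<close>

lemma mellin_inverse_one_plus_square:
  fixes c :: real
  assumes "-1 < c" "c < 1"
  shows "set_integrable lborel {0<..} (\<lambda>x. x powr c / (1 + x\<^sup>2))"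
    and "(LINT x:{0<..}|lborel. x powr c / (1 + x\<^sup>2)) = pi / (2 * cos (pi * c / 2))"
proof -
  define a where "a = (c + 1) / 2"
  let ?f = "\<lambda>y::real. y powr (a - 1) * (1 + y) powr (- a - (1 - a))"
  have a: "a > 0" "1 - a > 0" using assms by (auto simp: a_def)
  have val: "Beta a (1 - a) = pi / cos (pi * c / 2)"
  proof -
    have "Beta a (1 - a) = Gamma a * Gamma (1 - a)" by (simp add: Beta_def)
    also have "\<dots> = pi / sin (pi * a)" by (rule Gamma_reflection_real)
    also have "sin (pi * a) = cos (pi * c / 2)"
      using sin_add[of "pi * c / 2" "pi / 2"] by (simp add: a_def field_simps)
    finally show ?thesis .
  qed
  have eq: "\<bar>2 * x\<bar> * ?f (x\<^sup>2) = 2 * (x powr c / (1 + x\<^sup>2))" if "x \<in> {0<..}" for x :: real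
  proof -
    have "x\<^sup>2 powr (a - 1) = x powr (c - 1)"
    proof -
      have "x\<^sup>2 = x powr 2" using that by simp
      then have "x\<^sup>2 powr (a - 1) = x powr (2 * (a - 1))" by (simp only: powr_powr)
      also have "2 * (a - 1) = c - 1" by (simp add: a_def field_simps)
      finally show ?thesis .
    qed
    moreover have "x * x powr (c - 1) = x powr c" using that by (simp add: powr_diff)
    ultimately have "\<bar>2 * x\<bar> * ?f (x\<^sup>2) = 2 * (x * x powr (c - 1)) * (1 + x\<^sup>2) powr (-1)"
      using that by simp
    then show ?thesis using \<open>x * x powr (c - 1) = x powr c\<close>
      by (simp add: powr_minus divide_inverse add_nonneg_pos)
  qed
  have img: "(\<lambda>x::real. x\<^sup>2) ` {0<..} = {0<..}"
  proof (intro equalityI subsetI)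
    fix x :: real assume "x \<in> {0<..}"
    then have "x = (sqrt x)\<^sup>2" "sqrt x \<in> {0<..}" by auto
    then show "x \<in> (\<lambda>x::real. x\<^sup>2) ` {0<..}" by blast
  qed auto
  have "set_integrable lborel {0<..} ?f" and "(LINT x:{0<..}|lborel. ?f x) = pi / cos (pi * c / 2)"
    using beta_integral_half_line[OF a] val by auto
  then have "?f absolutely_integrable_on (\<lambda>x. x\<^sup>2) ` {0<..} \<and>
      integral ((\<lambda>x. x\<^sup>2) ` {0<..}) ?f = pi / cos (pi * c / 2)"
    unfolding img using set_borel_integral_eq_integral(2)[of "{0<..}" ?f]
    by (subst set_integrable_lborel_iff_absolutely_integrable[symmetric]) auto
  moreover have "((\<lambda>x::real. x\<^sup>2) has_field_derivative 2 * x) (at x within {0<..})" for x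
    by (auto intro!: derivative_eq_intros)
  moreover have "inj_on (\<lambda>x::real. x\<^sup>2) {0<..}"
    by (auto simp: inj_on_def)
  ultimately have *: "(\<lambda>x. \<bar>2 * x\<bar> * ?f (x\<^sup>2)) absolutely_integrable_on {0<..} \<and>
      integral {0<..} (\<lambda>x. \<bar>2 * x\<bar> * ?f (x\<^sup>2)) = pi / cos (pi * c / 2)"
    using has_absolute_integral_change_of_variables_1'[of "{0<..}" "\<lambda>x. x\<^sup>2" "\<lambda>x. 2 * x" ?f "pi / cos (pi * c / 2)"]
    by auto
  have "(\<lambda>x. 2 * (x powr c / (1 + x\<^sup>2))) absolutely_integrable_on {0<..}"
    using * by (subst (asm) set_integrable_cong[OF refl refl eq]) auto
  then have i: "(\<lambda>x. x powr c / (1 + x\<^sup>2)) absolutely_integrable_on {0<..}"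
    using set_integrable_mult_right[of "1 / 2 :: real" lebesgue "{0<..}" "\<lambda>x. 2 * (x powr c / (1 + x\<^sup>2))"] by simp
  show **: "set_integrable lborel {0<..} (\<lambda>x. x powr c / (1 + x\<^sup>2))"
    by (subst set_integrable_lborel_iff_absolutely_integrable) (use i in auto)
  have "integral {0<..} (\<lambda>x. 2 * (x powr c / (1 + x\<^sup>2))) = pi / cos (pi * c / 2)"
    using * by (subst (asm) integral_cong[OF eq]) auto
  then have "2 * integral {0<..} (\<lambda>x. x powr c / (1 + x\<^sup>2)) = pi / cos (pi * c / 2)"
    by (simp only: integral_mult_right)
  then show "(LINT x:{0<..}|lborel. x powr c / (1 + x\<^sup>2)) = pi / (2 * cos (pi * c / 2))"
    using set_borel_integral_eq_integral(2)[OF **] by simp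
qed

lemma gamma_integral_half_line:
  fixes s :: real
  assumes "s > 0"
  shows "set_integrable lborel {0<..} (\<lambda>x. x powr (s - 1) * exp (- x))"
    and "(LINT x:{0<..}|lborel. x powr (s - 1) * exp (- x)) = Gamma s"
proof -
  have hi: "((\<lambda>t. t powr (s - 1) / exp t) has_integral Gamma s) {0..}"
    using Gamma_integral_real[OF assms] .
  have hi: "((\<lambda>t. t powr (s - 1) * exp (- t)) has_integral Gamma s) {0<..}"
    using hi by (subst has_integral_spike_set_eq[of _ "{0..}"])
      (auto simp: exp_minus divide_inverse intro: negligible_subset[of "{0}"])
  then have "(\<lambda>t. t powr (s - 1) * exp (- t)) absolutely_integrable_on {0<..}"
    by (intro nonnegative_absolutely_integrable_1) auto
  then show *: "set_integrable lborel {0<..} (\<lambda>t. t powr (s - 1) * exp (- t))"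
    by (subst set_integrable_lborel_iff_absolutely_integrable) auto
  show "(LINT t:{0<..}|lborel. t powr (s - 1) * exp (- t)) = Gamma s"
    using set_borel_integral_eq_integral(2)[OF *] hi by (simp add: integral_unique)
qed

section \<open>Asymptotics of lattice convolutions\<close>

text \<open>The map x to -1 - x exchanges |x| and |x+1| and turns x < -1 into the positive half
  line; x to -x turns (-1,0) into (0,1). On that middle interval the first factor is on its positive
  side and the second on its negative side, so only \<open>p * m'\<close> occurs there. This term is
  what distinguishes the two orders of a pair of sequences.\<close>

lemma abs_power_product_integral:
  fixes d p m p' m' :: real
  assumes d: "0 < d" "d < 1 / 2"
  defines "F \<equiv> \<lambda>x. ((if x + 1 > 0 then p else m) * \<bar>x + 1\<bar> powr (d - 1)) *
                    ((if x > 0 then p' else m') * \<bar>x\<bar> powr (d - 1))"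
  shows "integrable lborel F"
    and "(\<integral>x. F x \<partial>lborel) = (p * p' + m * m') * Beta d (1 - 2 * d) + p * m' * Beta d d"
proof -
  define G where "G x = x powr (d - 1) * (1 + x) powr (d - 1)" for x :: real
  define H where "H x = x powr (d - 1) * (1 - x) powr (d - 1)" for x :: real
  have eqG: "- d - (1 - 2 * d) = d - 1" by simp
  have G: "integrable lborel (\<lambda>x. indicator {0<..} x * G x)"
      "(\<integral>x. indicator {0<..} x * G x \<partial>lborel) = Beta d (1 - 2 * d)"
    using beta_integral_half_line[of d "1 - 2 * d"] d
    unfolding set_integrable_def set_lebesgue_integral_def G_def eqG by auto
  have H: "integrable lborel (\<lambda>x. indicator {0<..<1} x * H x)"
      "(\<integral>x. indicator {0<..<1} x * H x \<partial>lborel) = Beta d d"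
    using beta_integral_open_interval[of d d] d
    unfolding set_integrable_def set_lebesgue_integral_def H_def by auto
  have G': "integrable lborel (\<lambda>x. indicator {0<..} (-1 - x) * G (-1 - x))"
      "(\<integral>x. indicator {0<..} (-1 - x) * G (-1 - x) \<partial>lborel) = Beta d (1 - 2 * d)"
    using lborel_integrable_real_affine[OF G(1), of "-1" "-1"] G
      lborel_integral_real_affine[of "-1" "\<lambda>x. indicator {0<..} x * G x" "-1"] by auto
  have H': "integrable lborel (\<lambda>x. indicator {0<..<1} (- x) * H (- x))"
      "(\<integral>x. indicator {0<..<1} (- x) * H (- x) \<partial>lborel) = Beta d d"
    using lborel_integrable_real_affine[OF H(1), of "-1" 0] H
      lborel_integral_real_affine[of "-1" "\<lambda>x. indicator {0<..<1} x * H x" 0] by auto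
  define K where "K x = p * p' * (indicator {0<..} x * G x) + m * m' * (indicator {0<..} (-1 - x) * G (-1 - x))
      + p * m' * (indicator {0<..<1} (- x) * H (- x))" for x
  have K: "integrable lborel K"
    unfolding K_def using G G' H' by auto
  have "(\<integral>x. K x \<partial>lborel) = p * p' * Beta d (1 - 2 * d) + m * m' * Beta d (1 - 2 * d) + p * m' * Beta d d"
    unfolding K_def using G G' H' by simp
  then have Kint: "(\<integral>x. K x \<partial>lborel) = (p * p' + m * m') * Beta d (1 - 2 * d) + p * m' * Beta d d"
    by (simp add: algebra_simps)
  have FK: "F x = K x" if "x \<noteq> 0" "x \<noteq> -1" for x
  proof -
    have "x > 0 \<or> x < -1 \<or> (-1 < x \<and> x < 0)" using that by linarith
    then consider "x > 0" | "x < -1" | "-1 < x" "x < 0" by blast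
    then show ?thesis
    proof cases
      case 1
      then show ?thesis by (simp add: F_def K_def G_def add.commute)
    next
      case 2
      then show ?thesis by (simp add: F_def K_def G_def add.commute)
    next
      case 3
      then show ?thesis by (simp add: F_def K_def H_def add.commute)
    qed
  qed
  have ae: "AE x in lborel. F x = K x"
    using AE_lborel_singleton[of "0::real"] AE_lborel_singleton[of "-1::real"]
    by eventually_elim (use FK in auto)
  have [measurable]: "F \<in> borel_measurable borel" unfolding F_def by measurable
  have [measurable]: "K \<in> borel_measurable borel" unfolding K_def G_def H_def by measurable
  show "integrable lborel F" using K by (subst integrable_cong_AE[OF _ _ ae]) auto
  show "(\<integral>x. F x \<partial>lborel) = (p * p' + m * m') * Beta d (1 - 2 * d) + p * m' * Beta d d"
    unfolding Kint[symmetric] by (rule integral_cong_AE[OF _ _ ae]) auto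
qed

text \<open>Up to the factor \<open>n\<close> the lattice sum is the integral of a step function. Rescaled, the step
  functions converge to a product of two powers and are dominated by such a product.\<close>

lemma lattice_convolution:
  fixes d p m p' m' :: real and a b :: "int \<Rightarrow> real"
  assumes d: "0 < d" "d < 1 / 2"
    and a: "two_sided_power (d - 1) a p m" and b: "two_sided_power (d - 1) b p' m'"
  shows "n > 0 \<Longrightarrow> integrable (count_space UNIV) (\<lambda>l. a (l + int n) * b l)"
    and "(\<lambda>n. real n powr (1 - 2 * d) * (\<integral>l. a (l + int n) * b l \<partial>count_space UNIV))
      \<longlonglongrightarrow> (p * p' + m * m') * Beta d (1 - 2 * d) + p * m' * Beta d d"
proof -
  obtain C where C: "C > 0" "\<And>l. \<bar>a l\<bar> \<le> C * (of_int \<bar>l\<bar> + 1) powr (d - 1)"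
    using two_sided_power_bound[OF a] d by auto
  obtain D where D: "D > 0" "\<And>l. \<bar>b l\<bar> \<le> D * (of_int \<bar>l\<bar> + 1) powr (d - 1)"
    using two_sided_power_bound[OF b] d by auto
  define W where "W x = (C * \<bar>x + 1\<bar> powr (d - 1)) * (D * \<bar>x\<bar> powr (d - 1))" for x
  have W: "integrable lborel W"
    using abs_power_product_integral(1)[OF d, of C C D D] unfolding W_def by simp
  define S where "S n x = (real n powr (1 - d) * a \<lfloor>real n * (x + 1)\<rfloor>) * (real n powr (1 - d) * b \<lfloor>real n * x\<rfloor>)" for n x
  have bound: "\<bar>S n x\<bar> \<le> W x" if "n > 0" "x \<noteq> 0" "x \<noteq> -1" for n x
    unfolding S_def W_def abs_mult[of "real n powr (1 - d) * a \<lfloor>real n * (x + 1)\<rfloor>"]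
    using two_sided_power_scaled_bound[OF C(2,1), of n "x + 1"]
      two_sided_power_scaled_bound[OF D(2,1), of n x] that d
    by (intro mult_mono) auto
  have conv: "(\<lambda>n. S n x) \<longlonglongrightarrow> ((if x + 1 > 0 then p else m) * \<bar>x + 1\<bar> powr (d - 1)) *
                    ((if x > 0 then p' else m') * \<bar>x\<bar> powr (d - 1))" if "x \<noteq> 0" "x \<noteq> -1" for x
    using tendsto_mult[OF two_sided_power_scaled[OF a, of "x + 1"] two_sided_power_scaled[OF b, of x]] that
    by (simp add: S_def)
  have [measurable]: "S n \<in> borel_measurable borel" for n
  proof -
    have "(\<lambda>x. f \<lfloor>real n * x + c\<rfloor>) \<in> borel_measurable borel" for f :: "int \<Rightarrow> real" and c :: real
      by measurable
    from this[of a "real n"] this[of b 0] show ?thesis unfolding S_def by (simp add: distrib_left)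
  qed
  have [measurable]: "W \<in> borel_measurable borel" unfolding W_def by measurable
  have ae0: "AE x in lborel. x \<noteq> 0 \<and> x \<noteq> (-1::real)"
    using AE_lborel_singleton[of "0::real"] AE_lborel_singleton[of "-1::real"] by auto
  \<comment> \<open>Multiplying the shift 1 by n gives an integer, so it passes through the floor
    exactly and becomes the lag \<open>int n\<close>.\<close>
  have Seq: "S n x = real n powr (2 - 2 * d) * (a (\<lfloor>real n * x\<rfloor> + int n) * b \<lfloor>real n * x\<rfloor>)" for n x
  proof -
    have "\<lfloor>real n * (x + 1)\<rfloor> = \<lfloor>real n * x\<rfloor> + int n" by (simp add: distrib_left)
    moreover have "real n powr (2 - 2 * d) = real n powr (1 - d) * real n powr (1 - d)"
      by (simp flip: powr_add)
    ultimately show ?thesis unfolding S_def by simp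
  qed
  show "integrable (count_space UNIV) (\<lambda>l. a (l + int n) * b l)" if "n > 0" for n
  proof -
    have "integrable lborel (S n)"
    proof (rule Bochner_Integration.integrable_bound[OF W])
      show "AE x in lborel. norm (S n x) \<le> norm (W x)"
        using ae0 by eventually_elim (use order_trans[OF bound[OF that] abs_ge_self] in auto)
    qed measurable
    then have "integrable lborel (\<lambda>x. a (\<lfloor>real n * x\<rfloor> + int n) * b \<lfloor>real n * x\<rfloor>)"
      using that unfolding Seq by simp
    then show ?thesis
      using integrable_lattice_scaled_iff[of "real n" "\<lambda>l. a (l + int n) * b l"] that by simp
  qed
  show "(\<lambda>n. real n powr (1 - 2 * d) * (\<integral>l. a (l + int n) * b l \<partial>count_space UNIV))
      \<longlonglongrightarrow> (p * p' + m * m') * Beta d (1 - 2 * d) + p * m' * Beta d d"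
  \<comment> \<open>The majorant is available only for n > 0, so the whole sequence is shifted to
    \<open>Suc n\<close>.\<close>
  proof (rule LIMSEQ_imp_Suc, rule Lim_transform_eventually)
    show "(\<lambda>n. \<integral>x. S (Suc n) x \<partial>lborel) \<longlonglongrightarrow> (p * p' + m * m') * Beta d (1 - 2 * d) + p * m' * Beta d d"
      unfolding abs_power_product_integral(2)[OF d, symmetric]
    proof (rule integral_dominated_convergence[OF _ _ W])
      show "AE x in lborel. (\<lambda>n. S (Suc n) x) \<longlonglongrightarrow> ((if x + 1 > 0 then p else m) * \<bar>x + 1\<bar> powr (d - 1)) *
                    ((if x > 0 then p' else m') * \<bar>x\<bar> powr (d - 1))"
        using ae0 by eventually_elim (use LIMSEQ_Suc[OF conv] in blast)
      show "AE x in lborel. norm (S (Suc n) x) \<le> W x" for n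
        using ae0 by eventually_elim (use bound[of "Suc n"] in auto)
    qed measurable
    show "\<forall>\<^sub>F n in sequentially. (\<integral>x. S (Suc n) x \<partial>lborel)
        = real (Suc n) powr (1 - 2 * d) * (\<integral>l. a (l + int (Suc n)) * b l \<partial>count_space UNIV)"
    proof (rule always_eventually, rule allI)
      fix n
      \<comment> \<open>The two scaled factors contribute the exponent 2 - 2d; one power is the
        inverse lattice spacing, used up in passing from the integral to the sum.\<close>
      have "real (Suc n) powr (1 - 2 * d) * real (Suc n) = real (Suc n) powr (2 - 2 * d)"
        using powr_add[of "real (Suc n)" "1 - 2 * d" 1] by simp
      then show "(\<integral>x. S (Suc n) x \<partial>lborel)
          = real (Suc n) powr (1 - 2 * d) * (\<integral>l. a (l + int (Suc n)) * b l \<partial>count_space UNIV)"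
        unfolding Seq integral_mult_right_zero
        using lattice_sum_scaled[of "real (Suc n)" "\<lambda>l. a (l + int (Suc n)) * b l"]
        by (simp add: mult.assoc[symmetric] del: of_nat_Suc)
    qed
  qed
qed

section \<open>Autocovariances of linear processes\<close>

lemma integrable_mult_of_squares:
  fixes U V :: "'w \<Rightarrow> real"
  assumes [measurable]: "U \<in> borel_measurable M" "V \<in> borel_measurable M"
    and U: "integrable M (\<lambda>w. (U w)\<^sup>2)" and V: "integrable M (\<lambda>w. (V w)\<^sup>2)"
  shows "integrable M (\<lambda>w. U w * V w)"
proof (rule Bochner_Integration.integrable_bound[OF Bochner_Integration.integrable_add[OF U V]])
  have "\<bar>u * v\<bar> \<le> u\<^sup>2 + v\<^sup>2" for u v :: real
  proof -
    have "2 * (\<bar>u\<bar> * \<bar>v\<bar>) \<le> u\<^sup>2 + v\<^sup>2"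
      using sum_squares_bound[of "\<bar>u\<bar>" "\<bar>v\<bar>"] by simp
    moreover have "0 \<le> \<bar>u\<bar> * \<bar>v\<bar>" by simp
    ultimately show ?thesis unfolding abs_mult by linarith
  qed
  then show "AE w in M. norm (U w * V w) \<le> norm ((U w)\<^sup>2 + (V w)\<^sup>2)" by auto
qed measurable

lemma cauchy_schwarz_integral:
  fixes U V :: "'w \<Rightarrow> real"
  assumes [measurable]: "U \<in> borel_measurable M" "V \<in> borel_measurable M"
    and U: "integrable M (\<lambda>w. (U w)\<^sup>2)" and V: "integrable M (\<lambda>w. (V w)\<^sup>2)"
  shows "\<bar>\<integral>w. U w * V w \<partial>M\<bar> \<le> sqrt (\<integral>w. (U w)\<^sup>2 \<partial>M) * sqrt (\<integral>w. (V w)\<^sup>2 \<partial>M)"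
proof -
  define a where "a = (\<integral>w. (U w)\<^sup>2 \<partial>M)"
  define b where "b = (\<integral>w. U w * V w \<partial>M)"
  define c where "c = (\<integral>w. (V w)\<^sup>2 \<partial>M)"
  note UV = integrable_mult_of_squares[OF assms]
  have quad: "0 \<le> a + 2 * t * b + t\<^sup>2 * c" for t
  proof -
    have "0 \<le> (\<integral>w. (U w + t * V w)\<^sup>2 \<partial>M)" by simp
    also have "(\<lambda>w. (U w + t * V w)\<^sup>2) = (\<lambda>w. (U w)\<^sup>2 + 2 * t * (U w * V w) + t\<^sup>2 * (V w)\<^sup>2)"
      by (simp add: power2_eq_square algebra_simps)
    also have "(\<integral>w. (U w)\<^sup>2 + 2 * t * (U w * V w) + t\<^sup>2 * (V w)\<^sup>2 \<partial>M) = a + 2 * t * b + t\<^sup>2 * c"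
      unfolding a_def b_def c_def using U V UV by simp
    finally show ?thesis .
  qed
  have "c \<ge> 0" unfolding c_def by simp
  have "b\<^sup>2 \<le> a * c"
  proof (cases "c = 0")
    case True
    have "b = 0"
    proof (rule ccontr)
      assume "b \<noteq> 0"
      \<comment> \<open>For c = 0 the quadratic is affine in t, and this t makes it equal to
        -1.\<close>
      then show False using quad[of "- (a + 1) / (2 * b)"] True by (simp add: field_simps)
    qed
    then show ?thesis using True by simp
  next
    case False
    then have "0 \<le> a - b\<^sup>2 / c"
      using quad[of "- b / c"] by (simp add: field_simps power2_eq_square)
    then show ?thesis using False \<open>c \<ge> 0\<close> by (simp add: field_simps)
  qed
  then have "sqrt (b\<^sup>2) \<le> sqrt (a * c)" by (rule real_sqrt_le_mono)
  then show ?thesis unfolding a_def b_def c_def by (simp add: real_sqrt_mult)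
qed

text \<open>Expand X'Z' = XZ - X(Z-Z') - (X-X')Z + (X-X')(Z-Z'). The last three integrals vanish in
  the limit by Cauchy-Schwarz.\<close>

lemma tendsto_integral_mult_L2:
  fixes X Z :: "'w \<Rightarrow> real" and X' Z' :: "nat \<Rightarrow> 'w \<Rightarrow> real"
  assumes [measurable]: "X \<in> borel_measurable M" "Z \<in> borel_measurable M"
      "\<And>n. X' n \<in> borel_measurable M" "\<And>n. Z' n \<in> borel_measurable M"
    and X: "integrable M (\<lambda>w. (X w)\<^sup>2)" and Z: "integrable M (\<lambda>w. (Z w)\<^sup>2)"
    and X': "\<And>n. integrable M (\<lambda>w. (X w - X' n w)\<^sup>2)" and Z': "\<And>n. integrable M (\<lambda>w. (Z w - Z' n w)\<^sup>2)"
    and limX: "(\<lambda>n. \<integral>w. (X w - X' n w)\<^sup>2 \<partial>M) \<longlonglongrightarrow> 0"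
    and limZ: "(\<lambda>n. \<integral>w. (Z w - Z' n w)\<^sup>2 \<partial>M) \<longlonglongrightarrow> 0"
  shows "(\<lambda>n. \<integral>w. X' n w * Z' n w \<partial>M) \<longlonglongrightarrow> (\<integral>w. X w * Z w \<partial>M)"
proof -
  \<comment> \<open>One statement serves all three error terms: the squared norms converge to
    \<open>u\<close> and \<open>v\<close>, and a single vanishing limit suffices. A fixed factor
    enters as a constant sequence.\<close>
  have null: "(\<lambda>n. \<integral>w. U n w * V n w \<partial>M) \<longlonglongrightarrow> 0"
    if "\<And>n. U n \<in> borel_measurable M" "\<And>n. V n \<in> borel_measurable M"
      "\<And>n. integrable M (\<lambda>w. (U n w)\<^sup>2)" "\<And>n. integrable M (\<lambda>w. (V n w)\<^sup>2)"
      "(\<lambda>n. \<integral>w. (U n w)\<^sup>2 \<partial>M) \<longlonglongrightarrow> u" "(\<lambda>n. \<integral>w. (V n w)\<^sup>2 \<partial>M) \<longlonglongrightarrow> v" "u * v = 0"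
    for U V :: "nat \<Rightarrow> 'w \<Rightarrow> real" and u v
  proof (rule tendsto_rabs_zero_cancel, rule tendsto_sandwich[OF _ _ tendsto_const])
    have "(\<lambda>n. sqrt (\<integral>w. (U n w)\<^sup>2 \<partial>M) * sqrt (\<integral>w. (V n w)\<^sup>2 \<partial>M)) \<longlonglongrightarrow> sqrt u * sqrt v"
      by (intro tendsto_intros that)
    then show "(\<lambda>n. sqrt (\<integral>w. (U n w)\<^sup>2 \<partial>M) * sqrt (\<integral>w. (V n w)\<^sup>2 \<partial>M)) \<longlonglongrightarrow> 0"
      using \<open>u * v = 0\<close> by (auto simp flip: real_sqrt_mult)
    show "\<forall>\<^sub>F n in sequentially. \<bar>\<integral>w. U n w * V n w \<partial>M\<bar> \<le>
        sqrt (\<integral>w. (U n w)\<^sup>2 \<partial>M) * sqrt (\<integral>w. (V n w)\<^sup>2 \<partial>M)"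
      using that by (intro always_eventually allI cauchy_schwarz_integral)
  qed auto
  have "(\<lambda>n. (\<integral>w. X w * Z w \<partial>M) - (\<integral>w. X w * (Z w - Z' n w) \<partial>M) - (\<integral>w. (X w - X' n w) * Z w \<partial>M)
      + (\<integral>w. (X w - X' n w) * (Z w - Z' n w) \<partial>M)) \<longlonglongrightarrow> (\<integral>w. X w * Z w \<partial>M) - 0 - 0 + 0"
  proof (intro tendsto_add tendsto_diff tendsto_const)
    show "(\<lambda>n. \<integral>w. X w * (Z w - Z' n w) \<partial>M) \<longlonglongrightarrow> 0"
      by (rule null[OF _ _ X Z' tendsto_const limZ]) simp_all
    show "(\<lambda>n. \<integral>w. (X w - X' n w) * Z w \<partial>M) \<longlonglongrightarrow> 0"
      by (rule null[OF _ _ X' Z limX tendsto_const]) simp_all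
    show "(\<lambda>n. \<integral>w. (X w - X' n w) * (Z w - Z' n w) \<partial>M) \<longlonglongrightarrow> 0"
      by (rule null[OF _ _ X' Z' limX limZ]) simp_all
  qed
  moreover have "(\<integral>w. X w * Z w \<partial>M) - (\<integral>w. X w * (Z w - Z' n w) \<partial>M) - (\<integral>w. (X w - X' n w) * Z w \<partial>M)
      + (\<integral>w. (X w - X' n w) * (Z w - Z' n w) \<partial>M) = (\<integral>w. X' n w * Z' n w \<partial>M)" for n
  proof -
    have i: "integrable M (\<lambda>w. X w * Z w)" "integrable M (\<lambda>w. X w * (Z w - Z' n w))"
      "integrable M (\<lambda>w. (X w - X' n w) * Z w)" "integrable M (\<lambda>w. (X w - X' n w) * (Z w - Z' n w))"
      by (intro integrable_mult_of_squares X X' Z Z'; measurable)+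
    have "(\<integral>w. X' n w * Z' n w \<partial>M) = (\<integral>w. X w * Z w - X w * (Z w - Z' n w) - (X w - X' n w) * Z w
        + (X w - X' n w) * (Z w - Z' n w) \<partial>M)"
      by (rule Bochner_Integration.integral_cong) (auto simp: algebra_simps)
    also have "\<dots> = (\<integral>w. X w * Z w \<partial>M) - (\<integral>w. X w * (Z w - Z' n w) \<partial>M) - (\<integral>w. (X w - X' n w) * Z w \<partial>M)
      + (\<integral>w. (X w - X' n w) * (Z w - Z' n w) \<partial>M)"
      using i by (simp del: Bochner_Integration.integral_diff add: Bochner_Integration.integral_diff)
    finally show ?thesis ..
  qed
  ultimately show ?thesis by simp
qed

lemma square_integrable_component:
  assumes "square_integrable M X"
  shows "(\<lambda>w. X w $ j) \<in> borel_measurable M" "integrable M (\<lambda>w. (X w $ j)\<^sup>2)"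
proof -
  have [measurable]: "X \<in> borel_measurable M" and i: "integrable M (\<lambda>w. (norm (X w))\<^sup>2)"
    using assms by (auto simp: square_integrable_def)
  show m[measurable]: "(\<lambda>w. X w $ j) \<in> borel_measurable M"
    by (rule borel_measurable_continuous_on[OF _ \<open>X \<in> borel_measurable M\<close>]) (intro continuous_intros)
  show "integrable M (\<lambda>w. (X w $ j)\<^sup>2)"
  proof (rule Bochner_Integration.integrable_bound[OF i])
    have "(x $ j)\<^sup>2 \<le> (norm x)\<^sup>2" for x :: "real^'b"
      using power_mono[OF component_le_norm_cart[of x j], of 2] by simp
    then show "AE w in M. norm ((X w $ j)\<^sup>2) \<le> norm ((norm (X w))\<^sup>2)" by simp
  qed measurable
qed

lemma square_integrable_add:
  assumes "square_integrable M X" "square_integrable M Z"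
  shows "square_integrable M (\<lambda>w. X w + Z w)"
proof -
  have [measurable]: "X \<in> borel_measurable M" "Z \<in> borel_measurable M"
    and i: "integrable M (\<lambda>w. 2 * (norm (X w))\<^sup>2 + 2 * (norm (Z w))\<^sup>2)"
    using assms by (auto simp: square_integrable_def)
  have "(norm (x + z))\<^sup>2 \<le> 2 * (norm x)\<^sup>2 + 2 * (norm z)\<^sup>2" for x z :: "real^'b"
  proof -
    have "(norm (x + z))\<^sup>2 \<le> (norm x + norm z)\<^sup>2"
      by (intro power_mono norm_triangle_ineq) auto
    also have "\<dots> \<le> 2 * (norm x)\<^sup>2 + 2 * (norm z)\<^sup>2"
      using sum_squares_bound[of "norm x" "norm z"] by (simp add: power2_sum)
    finally show ?thesis .
  qed
  then show ?thesis unfolding square_integrable_def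
    by (intro conjI Bochner_Integration.integrable_bound[OF i]) auto
qed

lemma square_integrable_matrix_mult:
  fixes A :: "real^'n^'m"
  assumes "square_integrable M X"
  shows "square_integrable M (\<lambda>w. A *v X w)"
proof -
  have [measurable]: "X \<in> borel_measurable M" and i: "integrable M (\<lambda>w. (norm (X w))\<^sup>2)"
    using assms by (auto simp: square_integrable_def)
  obtain K where K: "K > 0" "\<And>x. norm (A *v x) \<le> norm x * K"
    using bounded_linear.pos_bounded[OF matrix_vector_mul_bounded_linear[of A]] by blast
  have m[measurable]: "(\<lambda>w. A *v X w) \<in> borel_measurable M"
    by (rule borel_measurable_continuous_on[OF _ \<open>X \<in> borel_measurable M\<close>])
       (intro linear_continuous_on matrix_vector_mul_bounded_linear)
  have "integrable M (\<lambda>w. K\<^sup>2 * (norm (X w))\<^sup>2)" using i by simp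
  then have "integrable M (\<lambda>w. (norm (A *v X w))\<^sup>2)"
  proof (rule Bochner_Integration.integrable_bound)
    have "(norm (A *v x))\<^sup>2 \<le> K\<^sup>2 * (norm x)\<^sup>2" for x
      using power_mono[OF K(2)[of x], of 2] by (simp add: power_mult_distrib mult.commute)
    then show "AE w in M. norm ((norm (A *v X w))\<^sup>2) \<le> norm (K\<^sup>2 * (norm (X w))\<^sup>2)" by simp
  qed measurable
  then show ?thesis unfolding square_integrable_def using m by simp
qed

lemma square_integrable_sum:
  assumes "\<And>l. l \<in> I \<Longrightarrow> square_integrable M (X l)"
  shows "square_integrable M (\<lambda>w. \<Sum>l\<in>I. X l w)"
  using assms
proof (induction I rule: infinite_finite_induct)
  case (insert l I)
  then show ?case by (simp add: square_integrable_add)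
qed (simp_all add: square_integrable_def)

section \<open>Second moments of moving averages of white noise\<close>

lemma white_noise_moment:
  assumes "white_noise M \<epsilon>"
  shows "(\<integral>w. \<epsilon> n w $ a * \<epsilon> m w $ b \<partial>M) = (if n = m \<and> a = b then 1 else 0)"
proof (cases "n = m")
  case True
  then have "cross_moment M (\<epsilon> n) (\<epsilon> m) $ a $ b = mat 1 $ a $ b"
    using assms by (simp add: white_noise_def)
  then show ?thesis using True by (simp add: cross_moment_def mat_def)
next
  case False
  then have "cross_moment M (\<epsilon> n) (\<epsilon> m) $ a $ b = 0 $ a $ b"
    using assms by (simp add: white_noise_def)
  then show ?thesis using False by (simp add: cross_moment_def)
qed

lemma white_noise_moment_integrable:
  assumes "white_noise M \<epsilon>"
  shows "integrable M (\<lambda>w. \<epsilon> n w $ a * \<epsilon> m w $ b)"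
  using assms by (intro integrable_mult_of_squares square_integrable_component) (auto simp: white_noise_def)

text \<open>The coordinates of all noise vectors are orthonormal, so in the fourfold sum only equal
  times, m = l + h, and equal coordinates survive. Truncation leaves its trace in the condition that
  l + h lies in the window as well.\<close>

lemma cross_moment_moving_average:
  fixes A :: "int \<Rightarrow> real^'n^'m"
  assumes wn: "white_noise M \<epsilon>" and I: "finite I"
  shows "(\<integral>w. (\<Sum>l\<in>I. A l *v \<epsilon> (n + h - l) w) $ j * (\<Sum>l\<in>I. A l *v \<epsilon> (n - l) w) $ k \<partial>M)
    = (\<Sum>l\<in>I. if l + h \<in> I then \<Sum>a\<in>UNIV. A (l + h) $ j $ a * A l $ k $ a else 0)"
proof -
  have "(\<Sum>l\<in>I. A l *v \<epsilon> (n + h - l) w) $ j * (\<Sum>l\<in>I. A l *v \<epsilon> (n - l) w) $ k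
     = (\<Sum>m\<in>I. \<Sum>l\<in>I. \<Sum>a\<in>UNIV. \<Sum>b\<in>UNIV.
         A m $ j $ a * A l $ k $ b * (\<epsilon> (n + h - m) w $ a * \<epsilon> (n - l) w $ b))" for w
    unfolding sum_component matrix_vector_mult_def vec_lambda_beta sum_product
    by (intro sum.cong refl) (simp only: mult_ac)
  then have "(\<integral>w. (\<Sum>l\<in>I. A l *v \<epsilon> (n + h - l) w) $ j * (\<Sum>l\<in>I. A l *v \<epsilon> (n - l) w) $ k \<partial>M)
    = (\<integral>w. (\<Sum>m\<in>I. \<Sum>l\<in>I. \<Sum>a\<in>UNIV. \<Sum>b\<in>UNIV.
         A m $ j $ a * A l $ k $ b * (\<epsilon> (n + h - m) w $ a * \<epsilon> (n - l) w $ b)) \<partial>M)"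
    by (simp only:)
  also have "\<dots> = (\<Sum>m\<in>I. \<Sum>l\<in>I. \<Sum>a\<in>UNIV. \<Sum>b\<in>UNIV.
         A m $ j $ a * A l $ k $ b * (if n + h - m = n - l \<and> a = b then 1 else 0))"
    by (simp add: Bochner_Integration.integral_sum Bochner_Integration.integrable_sum
        white_noise_moment_integrable[OF wn] white_noise_moment[OF wn] del: mult_eq_0_iff)
  also have "\<dots> = (\<Sum>m\<in>I. \<Sum>l\<in>I. if m = l + h then \<Sum>a\<in>UNIV. A m $ j $ a * A l $ k $ a else 0)"
    by (intro sum.cong refl) (auto simp: if_distrib cong: if_cong)
  also have "\<dots> = (\<Sum>l\<in>I. \<Sum>m\<in>I. if m = l + h then \<Sum>a\<in>UNIV. A m $ j $ a * A l $ k $ a else 0)"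
    by (rule sum.swap)
  also have "\<dots> = (\<Sum>l\<in>I. if l + h \<in> I then \<Sum>a\<in>UNIV. A (l + h) $ j $ a * A l $ k $ a else 0)"
    using I by simp
  finally show ?thesis .
qed

text \<open>Cross moments pass to mean-square limits, and the truncated formula is a sum over those
  l for which l and l + h both lie in the window. These sets exhaust the integers, so domination by
  the full summand gives the limit. The limit does not involve n, which is what makes the
  description in \<open>autocov\<close> denote it.\<close>

lemma autocov_linear_process:
  fixes A :: "int \<Rightarrow> real^'n^'m"
  assumes wn: "white_noise M \<epsilon>" and lp: "linear_process M A \<epsilon> Y"
    and int: "\<And>j k. integrable (count_space UNIV) (\<lambda>l. \<Sum>a\<in>UNIV. A (l + h) $ j $ a * A l $ k $ a)"
  shows "autocov M Y h $ j $ k = (\<integral>l. (\<Sum>a\<in>UNIV. A (l + h) $ j $ a * A l $ k $ a) \<partial>count_space UNIV)"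
proof -
  define G :: "real^'m^'m" where
    "G = (\<chi> j k. \<integral>l. (\<Sum>a\<in>UNIV. A (l + h) $ j $ a * A l $ k $ a) \<partial>count_space UNIV)"
  define S where "S n N w = (\<Sum>l = - int N..int N. A l *v \<epsilon> (n - l) w)" for n N w
  have Y: "square_integrable M (Y n)" for n using lp by (simp add: linear_process_def)
  have S: "square_integrable M (S n N)" for n N
    unfolding S_def using wn
    by (intro square_integrable_sum square_integrable_matrix_mult) (simp add: white_noise_def)
  have YS: "square_integrable M (\<lambda>w. Y n w - S n N w)" for n N
    using square_integrable_add[OF Y, of "\<lambda>w. - S n N w"] S by (simp add: square_integrable_def)
  have lim: "(\<lambda>N. \<integral>w. (norm (Y n w - S n N w))\<^sup>2 \<partial>M) \<longlonglongrightarrow> 0" for n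
  proof -
    \<comment> \<open>Convergence with independent ends is used only along symmetric
      windows.\<close>
    have "filterlim (\<lambda>N. (int N, int N)) (at_top \<times>\<^sub>F at_top) sequentially"
      by (intro filterlim_Pair filterlim_int_sequentially)
    from filterlim_compose[OF _ this] lp show ?thesis
      unfolding linear_process_def S_def by fastforce
  qed
  have limc: "(\<lambda>N. \<integral>w. (Y n w $ j - S n N w $ j)\<^sup>2 \<partial>M) \<longlonglongrightarrow> 0" for n j
  proof (rule tendsto_sandwich[OF _ _ tendsto_const lim])
    show "\<forall>\<^sub>F N in sequentially. (\<integral>w. (Y n w $ j - S n N w $ j)\<^sup>2 \<partial>M) \<le> (\<integral>w. (norm (Y n w - S n N w))\<^sup>2 \<partial>M)"
    proof (intro always_eventually allI integral_mono)
      fix N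
      show "integrable M (\<lambda>w. (norm (Y n w - S n N w))\<^sup>2)" using YS by (simp add: square_integrable_def)
      show "integrable M (\<lambda>w. (Y n w $ j - S n N w $ j)\<^sup>2)"
        using square_integrable_component(2)[OF YS, of n N j] by simp
      show "(Y n w $ j - S n N w $ j)\<^sup>2 \<le> (norm (Y n w - S n N w))\<^sup>2" for w
        using power_mono[OF component_le_norm_cart[of "Y n w - S n N w" j], of 2] by simp
    qed
  qed auto
  have "cross_moment M (Y (n + h)) (Y n) = G" for n
  proof -
    have "cross_moment M (Y (n + h)) (Y n) $ j $ k = G $ j $ k" for j k
    proof (rule LIMSEQ_unique)
      have *: "integrable M (\<lambda>w. (Y n w $ j - S n N w $ j)\<^sup>2)" for n N j
        using square_integrable_component(2)[OF YS, of n N j] by simp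
      show "(\<lambda>N. \<integral>w. S (n + h) N w $ j * S n N w $ k \<partial>M) \<longlonglongrightarrow> cross_moment M (Y (n + h)) (Y n) $ j $ k"
        unfolding cross_moment_def vec_lambda_beta
        by (rule tendsto_integral_mult_L2)
           (intro square_integrable_component Y S * limc)+
      define f where "f l = (\<Sum>a\<in>UNIV. A (l + h) $ j $ a * A l $ k $ a)" for l
      define g where "g N l = (if l \<in> {- int N..int N} \<and> l + h \<in> {- int N..int N} then f l else 0)" for N l
      have "(\<lambda>N. \<integral>l. g N l \<partial>count_space UNIV) \<longlonglongrightarrow> (\<integral>l. f l \<partial>count_space UNIV)"
      proof (rule integral_dominated_convergence)
        show "integrable (count_space UNIV) (\<lambda>l. norm (f l))" using int[of j k] by (simp add: f_def)
        show "AE l in count_space UNIV. norm (g N l) \<le> norm (f l)" for N by (auto simp: g_def)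
        show "AE l in count_space UNIV. (\<lambda>N. g N l) \<longlonglongrightarrow> f l"
        proof (rule AE_I2)
          fix l
          have "\<forall>\<^sub>F N in sequentially. f l = g N l"
            using eventually_ge_at_top[of "nat (\<bar>l\<bar> + \<bar>h\<bar>)"]
            by eventually_elim (auto simp: g_def)
          then show "(\<lambda>N. g N l) \<longlonglongrightarrow> f l" by (rule Lim_transform_eventually[OF tendsto_const])
        qed
      qed auto
      moreover have "(\<integral>l. g N l \<partial>count_space UNIV) = (\<integral>w. S (n + h) N w $ j * S n N w $ k \<partial>M)" for N
      proof -
        have "(\<integral>l. g N l \<partial>count_space UNIV) = (\<Sum>l = - int N..int N. g N l)"
        proof -
          have sub: "{l. l \<in> UNIV \<and> g N l \<noteq> 0} \<subseteq> {- int N..int N}"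
            by (auto simp: g_def split: if_splits)
          have "(\<integral>l. g N l \<partial>count_space UNIV) = (\<Sum>l | l \<in> UNIV \<and> g N l \<noteq> 0. g N l)"
            by (rule lebesgue_integral_count_space_finite_support) (use finite_subset[OF sub] in simp)
          also have "\<dots> = (\<Sum>l = - int N..int N. g N l)"
            by (rule sum.mono_neutral_left[OF _ sub]) auto
          finally show ?thesis .
        qed
        also have "\<dots> = (\<Sum>l = - int N..int N. if l + h \<in> {- int N..int N} then f l else 0)"
          by (intro sum.cong) (auto simp: g_def)
        also have "\<dots> = (\<integral>w. S (n + h) N w $ j * S n N w $ k \<partial>M)"
          unfolding S_def f_def using cross_moment_moving_average[OF wn, of "{- int N..int N}" A n h j k] by simp
        finally show ?thesis .
      qed
      ultimately show "(\<lambda>N. \<integral>w. S (n + h) N w $ j * S n N w $ k \<partial>M) \<longlonglongrightarrow> G $ j $ k"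
        by (simp add: G_def f_def)
    qed
    then show ?thesis by (simp add: vec_eq_iff)
  qed
  then have "autocov M Y h = G"
    unfolding autocov_def by (intro the_equality) auto
  then show ?thesis by (simp add: G_def)
qed

section \<open>Abel sums and the spectral density at the origin\<close>

text \<open>At h = n x the summand is close to n^(s-1) b x^(s-1) exp(-x), and the points h / n have
  spacing 1/n. The sum is therefore n^s times a Riemann sum of b times the Gamma integral.\<close>

lemma abel_sum_scaled:
  fixes \<gamma> :: "int \<Rightarrow> real"
  assumes s: "0 < s" "s < 1" and \<gamma>: "((\<lambda>l. \<gamma> l / of_int l powr (s - 1)) \<longlongrightarrow> b) at_top"
  shows "(\<lambda>n. real (Suc n) powr (- s) * (\<Sum>k. exp (- ((real k + 1) / real (Suc n))) * \<gamma> (int k + 1)))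
    \<longlonglongrightarrow> b * Gamma s"
proof -
  obtain C where C: "C > 0" "\<And>l. l \<ge> 0 \<Longrightarrow> \<bar>\<gamma> l\<bar> \<le> C * (of_int l + 1) powr (s - 1)"
    using power_bound_at_top[OF \<gamma>] s by auto
  \<comment> \<open>The lag is l + 1 rather than l. This leaves out lag 0, and with l the floor of n
    x it gives (l + 1) / n \<ge> x, so that both the exponential and the power are bounded by their
    values at x.\<close>
  define f where "f n l = (if l \<ge> 0 then exp (- ((real_of_int l + 1) / real n)) * \<gamma> (l + 1) else 0)" for n :: nat and l :: int
  define S where "S n x = real n powr (1 - s) * f n \<lfloor>real n * x\<rfloor>" for n and x :: real
  define W where "W x = C * (indicator {0<..} x * (x powr (s - 1) * exp (- x)))" for x :: real
  have W: "integrable lborel W"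
    using gamma_integral_half_line(1)[OF s(1)] unfolding set_integrable_def W_def by auto
  have [measurable]: "W \<in> borel_measurable borel" unfolding W_def by measurable
  have [measurable]: "S n \<in> borel_measurable borel" for n unfolding S_def by measurable
  have bound: "\<bar>S n x\<bar> \<le> W x" if "n > 0" "x \<noteq> 0" for n x
  proof (cases "x > 0")
    case True
    define l where "l = \<lfloor>real n * x\<rfloor>"
    have l: "l \<ge> 0" "real n * x \<le> of_int l + 1" using True that unfolding l_def
      by (simp, linarith)
    have "(of_int (l + 1) + 1) powr (s - 1) \<le> (real n * x) powr (s - 1)"
      by (rule powr_mono2') (use l True that s in auto)
    then have "C * (of_int (l + 1) + 1) powr (s - 1) \<le> C * (real n * x) powr (s - 1)"
      by (rule mult_left_mono) (use C in auto)
    with C(2)[of "l + 1"] l have 1: "\<bar>\<gamma> (l + 1)\<bar> \<le> C * (real n * x) powr (s - 1)" by linarith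
    have "x \<le> (of_int l + 1) / real n" using l that by (simp add: field_simps)
    then have 2: "exp (- ((of_int l + 1) / real n)) \<le> exp (- x)" by simp
    have "exp (- ((of_int l + 1) / real n)) * \<bar>\<gamma> (l + 1)\<bar> \<le> exp (- x) * (C * (real n * x) powr (s - 1))"
      by (intro mult_mono 1 2) auto
    then have "real n powr (1 - s) * (exp (- ((of_int l + 1) / real n)) * \<bar>\<gamma> (l + 1)\<bar>)
        \<le> real n powr (1 - s) * (exp (- x) * (C * (real n * x) powr (s - 1)))"
      by (rule mult_left_mono) auto
    also have "\<dots> = (real n powr (1 - s) * real n powr (s - 1)) * (C * (x powr (s - 1) * exp (- x)))"
      using that True by (simp add: powr_mult mult_ac)
    also have "real n powr (1 - s) * real n powr (s - 1) = 1"
      using that by (simp flip: powr_add)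
    finally show ?thesis
      using l True unfolding S_def W_def f_def l_def[symmetric] by (simp add: abs_mult)
  next
    case False
    with that have "\<lfloor>real n * x\<rfloor> < 0" by (simp add: mult_pos_neg)
    then show ?thesis using False by (simp add: S_def f_def W_def)
  qed
  have conv: "(\<lambda>n. S n x) \<longlonglongrightarrow> indicator {0<..} x * (b * x powr (s - 1) * exp (- x))" if "x \<noteq> 0" for x
  proof (cases "x > 0")
    case True
    have k: "(\<lambda>n. of_int (\<lfloor>real n * x\<rfloor> + 1) / real n) \<longlonglongrightarrow> x"
      using tendsto_add[OF floor_scaled_tendsto[of x] lim_inverse_n'] by (simp add: add_divide_distrib)
    have "(\<lambda>n. real n powr (- (s - 1)) * \<gamma> (\<lfloor>real n * x\<rfloor> + 1)) \<longlonglongrightarrow> b * x powr (s - 1)"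
      by (rule scaled_power_tendsto[OF \<gamma> k True])
    moreover have "(\<lambda>n. exp (- (of_int (\<lfloor>real n * x\<rfloor> + 1) / real n))) \<longlonglongrightarrow> exp (- x)"
      by (intro tendsto_intros k)
    ultimately have "(\<lambda>n. real n powr (- (s - 1)) * \<gamma> (\<lfloor>real n * x\<rfloor> + 1) * exp (- (of_int (\<lfloor>real n * x\<rfloor> + 1) / real n)))
        \<longlonglongrightarrow> b * x powr (s - 1) * exp (- x)"
      by (rule tendsto_mult)
    moreover have "real n powr (- (s - 1)) * \<gamma> (\<lfloor>real n * x\<rfloor> + 1) * exp (- (of_int (\<lfloor>real n * x\<rfloor> + 1) / real n)) = S n x" for n
      using True by (simp add: S_def f_def mult_ac)
    ultimately show ?thesis using True by simp
  next
    case False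
    have "S n x = 0" if "n > 0" for n
    proof -
      have "\<lfloor>real n * x\<rfloor> < 0" using False \<open>x \<noteq> 0\<close> that by (simp add: mult_pos_neg)
      then show ?thesis by (simp add: S_def f_def)
    qed
    then have "\<forall>\<^sub>F n in sequentially. 0 = S n x"
      by (intro eventually_mono[OF eventually_gt_at_top[of 0]]) simp
    then show ?thesis using False by (intro Lim_transform_eventually[OF tendsto_const]) auto
  qed
  have ae0: "AE x in lborel. x \<noteq> (0::real)"
    by (rule AE_lborel_singleton)
  have Sint: "integrable lborel (S n)" if "n > 0" for n
  proof (rule Bochner_Integration.integrable_bound[OF W])
    show "AE x in lborel. norm (S n x) \<le> norm (W x)"
      using ae0 by eventually_elim (use order_trans[OF bound[OF that] abs_ge_self] in auto)
  qed measurable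
  have fint: "integrable (count_space UNIV) (f n)" if "n > 0" for n
  proof -
    have "integrable lborel (\<lambda>x. f n \<lfloor>real n * x\<rfloor>)" using Sint[OF that] that by (simp add: S_def[abs_def])
    then show ?thesis using integrable_lattice_scaled_iff[of "real n" "f n"] that by simp
  qed
  have series: "(\<Sum>k. exp (- ((real k + 1) / real n)) * \<gamma> (int k + 1)) = (\<integral>l. f n l \<partial>count_space UNIV)" if "n > 0" for n
  proof -
    have bij: "bij_betw int UNIV {0..}"
      by (rule bij_betwI[where g = nat]) auto
    have ind: "f n = (\<lambda>l. indicator {0..} l *\<^sub>R f n l)" by (auto simp: f_def indicator_def)
    have "(\<integral>l. f n l \<partial>count_space UNIV) = (\<integral>l. f n l \<partial>restrict_space (count_space UNIV) {0..})"
      by (subst integral_restrict_space) (use ind in \<open>auto simp flip: ind\<close>)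
    also have "\<dots> = (\<integral>l. f n l \<partial>count_space {0..})"
      by (simp add: restrict_count_space)
    also have "\<dots> = (\<integral>k. f n (int k) \<partial>count_space UNIV)"
      by (rule integral_bij_count_space[OF bij, symmetric])
    also have "\<dots> = (\<Sum>k. f n (int k))"
    proof (rule integral_count_space_nat)
      have "integrable (count_space {0..}) (f n)"
        using fint[OF that] ind integrable_restrict_space[of "{0..}" "count_space UNIV" "f n"]
        by (auto simp: restrict_count_space)
      then show "integrable (count_space UNIV) (\<lambda>k. f n (int k))"
        using integrable_bij_count_space[OF bij, of "f n"] by simp
    qed
    finally show ?thesis by (simp add: f_def)
  qed
  have "(\<lambda>n. \<integral>x. S (Suc n) x \<partial>lborel) \<longlonglongrightarrow> (\<integral>x. indicator {0<..} x * (b * x powr (s - 1) * exp (- x)) \<partial>lborel)"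
  proof (rule integral_dominated_convergence[OF _ _ W])
    show "AE x in lborel. (\<lambda>n. S (Suc n) x) \<longlonglongrightarrow> indicator {0<..} x * (b * x powr (s - 1) * exp (- x))"
      using ae0 by eventually_elim (use LIMSEQ_Suc[OF conv] in blast)
    show "AE x in lborel. norm (S (Suc n) x) \<le> W x" for n
      using ae0 by eventually_elim (use bound[of "Suc n"] in auto)
  qed measurable
  also have "(\<integral>x. indicator {0<..} x * (b * x powr (s - 1) * exp (- x)) \<partial>lborel) = b * Gamma s"
  proof -
    have "(\<lambda>x. indicator {0<..} x * (b * x powr (s - 1) * exp (- x)))
        = (\<lambda>x. b * (indicator {0<..} x * (x powr (s - 1) * exp (- x))))"
      by (auto simp: mult_ac)
    then show ?thesis
      using gamma_integral_half_line(2)[OF s(1)] by (simp add: set_lebesgue_integral_def)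
  qed
  also have "(\<lambda>n. \<integral>x. S (Suc n) x \<partial>lborel) =
      (\<lambda>n. real (Suc n) powr (- s) * (\<Sum>k. exp (- ((real k + 1) / real (Suc n))) * \<gamma> (int k + 1)))"
  proof
    fix n
    have "real (Suc n) powr (- s) * real (Suc n) = real (Suc n) powr (1 - s)"
      using powr_add[of "real (Suc n)" "- s" 1] by (simp add: add.commute)
    then show "(\<integral>x. S (Suc n) x \<partial>lborel) =
        real (Suc n) powr (- s) * (\<Sum>k. exp (- ((real k + 1) / real (Suc n))) * \<gamma> (int k + 1))"
      unfolding series[OF zero_less_Suc] S_def integral_mult_right_zero
      using lattice_sum_scaled[of "real (Suc n)" "f (Suc n)"]
      by (simp add: mult.assoc[symmetric] del: of_nat_Suc)
  qed
  finally show ?thesis .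
qed

section \<open>Functions on the circle with vanishing Fourier coefficients\<close>

lemma integrable_mult_bounded:
  fixes g U :: "'a \<Rightarrow> complex"
  assumes "integrable M U" "g \<in> borel_measurable M" "\<And>x. norm (g x) \<le> B"
  shows "integrable M (\<lambda>x. g x * U x)"
proof (rule Bochner_Integration.integrable_bound)
  show "integrable M (\<lambda>x. B * norm (U x))" using assms by simp
  show "(\<lambda>x. g x * U x) \<in> borel_measurable M" using assms by simp
  have "B \<ge> 0" using assms(3)[of undefined] norm_ge_zero order_trans by blast
  then show "AE x in M. norm (g x * U x) \<le> norm (B * norm (U x))"
    using assms(3) by (auto simp: norm_mult intro!: mult_right_mono)
qed

lemma borel_measurable_lebesgue_of_borel:
  fixes f :: "real \<Rightarrow> 'b :: topological_space"
  shows "f \<in> borel_measurable borel \<Longrightarrow> f \<in> borel_measurable lebesgue"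
  by (rule measurable_completion) simp

lemma continuous_on_circle_measurable:
  fixes g :: "complex \<Rightarrow> 'b :: topological_space"
  assumes "continuous_on (sphere 0 1) g"
  shows "(\<lambda>x. g (cis x)) \<in> borel_measurable borel"
  by (intro borel_measurable_continuous_onI continuous_on_compose2[OF assms])
     (auto intro!: continuous_intros simp: cis_conv_exp)

text \<open>The multipliers preserving the class of functions with vanishing Fourier coefficients form
  a ring containing the real linear functions on the circle, hence all polynomials.\<close>

lemma fourier_zero_polynomial:
  fixes p :: "complex \<Rightarrow> real" and U :: "real \<Rightarrow> complex"
  assumes "real_polynomial_function p"
    and "integrable lebesgue U" "\<And>h::int. (\<integral>x. cis (of_int h * x) * U x \<partial>lebesgue) = 0"
  shows "integrable lebesgue (\<lambda>x. of_real (p (cis x)) * U x) \<and>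
    (\<forall>h::int. (\<integral>x. cis (of_int h * x) * (of_real (p (cis x)) * U x) \<partial>lebesgue) = 0)"
  using assms
proof (induction arbitrary: U)
  case (linear f)
  have m: "(\<lambda>x. cis (of_int h * x)) \<in> borel_measurable lebesgue" for h :: int
    by (intro borel_measurable_lebesgue_of_borel borel_measurable_continuous_onI)
       (auto intro!: continuous_intros simp: cis_conv_exp)
  have i: "integrable lebesgue (\<lambda>x. cis (of_int h * x) * U x)" for h :: int
    by (rule integrable_mult_bounded[OF linear(2) m, of _ 1]) simp
  \<comment> \<open>On the circle f equals f(1) cos x + f(i) sin x, which is twice the real part of
    c exp(ix) for c = (f(1) - i f(i)) / 2.\<close>
  define c where "c = (Complex (f 1) (- f \<i>)) / 2"
  have f: "complex_of_real (f (cis x)) = c * cis (of_int 1 * x) + cnj c * cis (of_int (-1) * x)" for x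
  proof -
    interpret f: bounded_linear f by (rule linear)
    have "f (cis x) = f (cos x *\<^sub>R 1 + sin x *\<^sub>R \<i>)"
      by (rule arg_cong[of _ _ f]) (auto simp: complex_eq_iff)
    also have "\<dots> = cos x * f 1 + sin x * f \<i>" by (simp add: f.add f.scaleR)
    finally show ?thesis by (simp add: c_def complex_eq_iff field_simps)
  qed
  have eq: "of_real (f (cis x)) * U x = c * (cis (of_int 1 * x) * U x) + cnj c * (cis (of_int (-1) * x) * U x)" for x
    unfolding f by (simp only: algebra_simps)
  \<comment> \<open>Multiplication by a linear function shifts frequencies by one in each direction;
    hence the induction carries all coefficients and not just the mean.\<close>
  have eq2: "cis (of_int h * x) * (of_real (f (cis x)) * U x)
      = c * (cis (of_int (h + 1) * x) * U x) + cnj c * (cis (of_int (h - 1) * x) * U x)" for x and h :: int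
  proof -
    have 1: "cis (of_int (h + 1) * x) = cis (of_int h * x) * cis (of_int 1 * x)"
      unfolding cis_mult by (rule arg_cong[of _ _ cis]) (simp add: algebra_simps)
    have 2: "cis (of_int (h - 1) * x) = cis (of_int h * x) * cis (of_int (-1) * x)"
      unfolding cis_mult by (rule arg_cong[of _ _ cis]) (simp add: algebra_simps)
    show ?thesis unfolding f 1 2 by (simp only: algebra_simps)
  qed
  show ?case
  proof (intro conjI allI)
    show "integrable lebesgue (\<lambda>x. of_real (f (cis x)) * U x)"
      unfolding eq by (intro Bochner_Integration.integrable_add integrable_mult_right i)
    show "(\<integral>x. cis (of_int h * x) * (of_real (f (cis x)) * U x) \<partial>lebesgue) = 0" for h :: int
      unfolding eq2
      by (subst Bochner_Integration.integral_add)
         (use i linear(3) in \<open>simp_all only: integrable_mult_right integral_mult_right_zero mult_zero_right add_0\<close>)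
  qed
next
  case (const c)
  have "(\<lambda>x. cis (of_int h * x) * (of_real c * U x)) = (\<lambda>x. of_real c * (cis (of_int h * x) * U x))" for h :: int
    by (simp only: mult_ac)
  then show ?case using const by (simp del: mult_eq_0_iff)
next
  case (add f g)
  note F = add.IH(1)[OF add.prems] and G = add.IH(2)[OF add.prems]
  have m: "(\<lambda>x. cis (of_int h * x)) \<in> borel_measurable lebesgue" for h :: int
    by (intro borel_measurable_lebesgue_of_borel borel_measurable_continuous_onI)
       (auto intro!: continuous_intros simp: cis_conv_exp)
  have i: "integrable lebesgue (\<lambda>x. cis (of_int h * x) * (of_real (f (cis x)) * U x))"
    "integrable lebesgue (\<lambda>x. cis (of_int h * x) * (of_real (g (cis x)) * U x))" for h :: int
    by (rule integrable_mult_bounded[of _ _ _ 1]; use F G m in simp)+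
  show ?case
    using F G i by (simp add: distrib_left distrib_right del: mult_eq_0_iff)
next
  case (mult f g)
  \<comment> \<open>The hypothesis for \<open>f\<close> is applied not to \<open>U\<close> but to
    the product of \<open>g\<close> with \<open>U\<close>, whose coefficients vanish by the
    hypothesis for \<open>g\<close>. This is why \<open>U\<close> is arbitrary in the
    induction.\<close>
  note G = mult.IH(2)[OF mult.prems]
  note mult.IH(1)[OF conjunct1[OF G]] 
  then show ?case using G by (simp add: mult.assoc)
qed

text \<open>Stone-Weierstrass on the circle, a compact subset of the plane, approximates
  \<open>g\<close> uniformly by real polynomials. These integrate to 0 against \<open>U\<close>, so
  the integral is at most the uniform error times the L1 norm of \<open>U\<close>.\<close>

lemma fourier_zero_continuous:
  fixes g :: "complex \<Rightarrow> real" and U :: "real \<Rightarrow> complex"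
  assumes g: "continuous_on (sphere 0 1) g"
    and U: "integrable lebesgue U" "\<And>h::int. (\<integral>x. cis (of_int h * x) * U x \<partial>lebesgue) = 0"
  shows "(\<integral>x. of_real (g (cis x)) * U x \<partial>lebesgue) = 0"
proof -
  define B where "B = (\<integral>x. norm (U x) \<partial>lebesgue)"
  have "\<exists>p. real_polynomial_function p \<and> (\<forall>x\<in>sphere 0 1. \<bar>g x - p x\<bar> < 1 / real (Suc n))" for n
    using Stone_Weierstrass_real_polynomial_function[of "sphere 0 1" g "1 / real (Suc n)"] g
    by (metis compact_sphere of_nat_0_less_iff zero_less_Suc zero_less_divide_1_iff)
  then obtain p where p: "\<And>n. real_polynomial_function (p n)"
      "\<And>n x. x \<in> sphere 0 1 \<Longrightarrow> \<bar>g x - p n x\<bar> < 1 / real (Suc n)"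
    by metis
  have bdd: "\<exists>G. \<forall>x. norm (complex_of_real (g (cis x))) \<le> G"
  proof -
    have "bounded (g ` sphere 0 1)"
      by (rule compact_imp_bounded[OF compact_continuous_image[OF g compact_sphere]])
    then obtain G where "\<forall>y\<in>g ` sphere 0 1. norm y \<le> G" unfolding bounded_iff by blast
    then show ?thesis by (intro exI[of _ G]) auto
  qed
  have gm: "(\<lambda>x. complex_of_real (g (cis x))) \<in> borel_measurable lebesgue"
    using borel_measurable_lebesgue_of_borel[OF continuous_on_circle_measurable[OF g]] by simp
  have gi: "integrable lebesgue (\<lambda>x. complex_of_real (g (cis x)) * U x)"
    using integrable_mult_bounded[OF U(1) gm] bdd by blast
  have bound: "norm (\<integral>x. of_real (g (cis x)) * U x \<partial>lebesgue) \<le> B * (1 / real (Suc n))" for n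
  proof -
    note P = fourier_zero_polynomial[OF p(1)[of n] U]
    have P0: "(\<integral>x. of_real (p n (cis x)) * U x \<partial>lebesgue) = 0"
      using P[THEN conjunct2, rule_format, of 0] by simp
    have "(\<integral>x. of_real (g (cis x)) * U x \<partial>lebesgue) =
        (\<integral>x. of_real (g (cis x)) * U x - of_real (p n (cis x)) * U x \<partial>lebesgue)"
      using gi P P0 by simp
    also have "norm \<dots> \<le> (\<integral>x. norm (of_real (g (cis x)) * U x - of_real (p n (cis x)) * U x) \<partial>lebesgue)"
      by (rule integral_norm_bound)
    also have "\<dots> \<le> (\<integral>x. norm (U x) * (1 / real (Suc n)) \<partial>lebesgue)"
    proof (rule integral_mono)
      show "integrable lebesgue (\<lambda>x. norm (of_real (g (cis x)) * U x - of_real (p n (cis x)) * U x))"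
        using gi P by simp
      show "integrable lebesgue (\<lambda>x. norm (U x) * (1 / real (Suc n)))" using U by simp
      fix x :: real
      have "of_real (g (cis x)) * U x - of_real (p n (cis x)) * U x = of_real (g (cis x) - p n (cis x)) * U x"
        by (simp add: algebra_simps)
      then have "norm (of_real (g (cis x)) * U x - of_real (p n (cis x)) * U x) = \<bar>g (cis x) - p n (cis x)\<bar> * norm (U x)"
        by (simp only: norm_mult norm_of_real)
      also have "\<dots> \<le> (1 / real (Suc n)) * norm (U x)"
        by (rule mult_right_mono) (use p(2)[of "cis x" n] in auto)
      finally show "norm (of_real (g (cis x)) * U x - of_real (p n (cis x)) * U x) \<le> norm (U x) * (1 / real (Suc n))"
        by (simp add: mult.commute)
    qed
    also have "\<dots> = B * (1 / real (Suc n))" unfolding B_def by (rule integral_mult_left_zero)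
    finally show ?thesis .
  qed
  have "norm (\<integral>x. of_real (g (cis x)) * U x \<partial>lebesgue) \<le> B * 0"
    by (rule LIMSEQ_le_const[OF tendsto_mult[OF tendsto_const LIMSEQ_Suc[OF lim_inverse_n']]])
       (use bound in auto)
  then show ?thesis by simp
qed

text \<open>The indicator of the open lower half circle is the bounded pointwise limit of the
  continuous cut-offs \<open>\<theta> n\<close>, which equal 1 once -Im z reaches 1/n and vanish
  where Im z \<ge> 0. Dominated convergence then carries the vanishing over to this discontinuous
  multiplier.\<close>

lemma fourier_zero_half_circle:
  fixes K :: "complex \<Rightarrow> complex" and U :: "real \<Rightarrow> complex"
  assumes K: "continuous_on (sphere 0 1) K"
    and U: "integrable lebesgue U" "\<And>h::int. (\<integral>x. cis (of_int h * x) * U x \<partial>lebesgue) = 0"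
    and supp: "\<And>x. x \<notin> {-pi..pi} \<Longrightarrow> U x = 0"
  shows "(\<integral>x. indicator {-pi<..<0} x * (K (cis x) * U x) \<partial>lebesgue) = 0"
proof -
  define \<theta> where "\<theta> n z = min 1 (real n * max 0 (- Im z))" for n z
  have \<theta>c: "continuous_on (sphere 0 1) (\<theta> n)" for n unfolding \<theta>_def by (intro continuous_intros)
  have \<theta>b: "norm (complex_of_real (\<theta> n z)) \<le> 1" for n z by (simp add: \<theta>_def)
  have \<theta>m: "(\<lambda>x. complex_of_real (\<theta> n (cis x))) \<in> borel_measurable lebesgue" for n
    using borel_measurable_lebesgue_of_borel[OF continuous_on_circle_measurable[OF \<theta>c]] by simp
  have KU: "integrable lebesgue (\<lambda>x. K (cis x) * U x)"
  proof -
    have "bounded (K ` sphere 0 1)"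
      by (rule compact_imp_bounded[OF compact_continuous_image[OF K compact_sphere]])
    then obtain G where "\<forall>y\<in>K ` sphere 0 1. norm y \<le> G" unfolding bounded_iff by blast
    then show ?thesis
      by (intro integrable_mult_bounded[OF U(1), of _ G]
          borel_measurable_lebesgue_of_borel continuous_on_circle_measurable[OF K]) auto
  qed
  have zero: "(\<integral>x. of_real (\<theta> n (cis x)) * (K (cis x) * U x) \<partial>lebesgue) = 0" for n
  proof -
    have i: "integrable lebesgue (\<lambda>x. of_real (g (cis x)) * U x)"
      "(\<integral>x. of_real (g (cis x)) * U x \<partial>lebesgue) = 0" if "continuous_on (sphere 0 1) g" for g :: "complex \<Rightarrow> real"
    proof -
      have "bounded (g ` sphere 0 1)"
        by (rule compact_imp_bounded[OF compact_continuous_image[OF that compact_sphere]])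
      then obtain G where "\<forall>y\<in>g ` sphere 0 1. norm y \<le> G" unfolding bounded_iff by blast
      then show "integrable lebesgue (\<lambda>x. of_real (g (cis x)) * U x)"
        using borel_measurable_lebesgue_of_borel[OF continuous_on_circle_measurable[OF that]]
        by (intro integrable_mult_bounded[OF U(1), of _ G]) auto
      show "(\<integral>x. of_real (g (cis x)) * U x \<partial>lebesgue) = 0"
        by (rule fourier_zero_continuous[OF that U])
    qed
    \<comment> \<open>The result for continuous multipliers concerns real functions, so
      \<open>K\<close> is split into real and imaginary parts.\<close>
    have c: "continuous_on (sphere 0 1) (\<lambda>z. \<theta> n z * Re (K z))" "continuous_on (sphere 0 1) (\<lambda>z. \<theta> n z * Im (K z))"
      by (intro continuous_intros \<theta>c K)+
    have "of_real (\<theta> n (cis x)) * (K (cis x) * U x) = of_real (\<theta> n (cis x) * Re (K (cis x))) * U x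
        + \<i> * (of_real (\<theta> n (cis x) * Im (K (cis x))) * U x)" for x
      by (simp add: complex_eq_iff algebra_simps)
    then show ?thesis using i[OF c(1)] i[OF c(2)] by simp
  qed
  have "(\<lambda>n. \<integral>x. of_real (\<theta> n (cis x)) * (K (cis x) * U x) \<partial>lebesgue)
      \<longlonglongrightarrow> (\<integral>x. indicator {-pi<..<0} x * (K (cis x) * U x) \<partial>lebesgue)"
  proof (rule integral_dominated_convergence)
    show "integrable lebesgue (\<lambda>x. norm (K (cis x) * U x))" using KU by simp
    show "AE x in lebesgue. norm (of_real (\<theta> n (cis x)) * (K (cis x) * U x)) \<le> norm (K (cis x) * U x)" for n
      using \<theta>b by (auto simp: norm_mult intro!: mult_left_le_one_le)
    show "AE x in lebesgue. (\<lambda>n. of_real (\<theta> n (cis x)) * (K (cis x) * U x))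
        \<longlonglongrightarrow> indicator {-pi<..<0} x * (K (cis x) * U x)"
    proof (rule AE_I2)
      fix x :: real
      consider "x \<notin> {-pi..pi}" | "-pi < x" "x < 0" | "x = -pi" | "0 \<le> x" "x \<le> pi"
        by fastforce
      then show "(\<lambda>n. of_real (\<theta> n (cis x)) * (K (cis x) * U x))
          \<longlonglongrightarrow> indicator {-pi<..<0} x * (K (cis x) * U x)"
      proof cases
        case 1
        then show ?thesis using supp[of x] by simp
      next
        case 2
        then have "sin (- x) > 0" by (intro sin_gt_zero) auto
        then have "sin x < 0" by simp
        obtain N where "1 / (- sin x) \<le> real N" using real_arch_simple by blast
        then have N: "1 \<le> real N * (- sin x)" using \<open>sin x < 0\<close> by (simp add: field_simps)
        have "1 \<le> real n * (- sin x)" if "n \<ge> N" for n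
          using mult_right_mono[of "real N" "real n" "- sin x"] that \<open>sin x < 0\<close> N by linarith
        then have "\<forall>\<^sub>F n in sequentially. 1 \<le> real n * (- sin x)"
          by (auto simp: eventually_sequentially)
        then have "\<forall>\<^sub>F n in sequentially. K (cis x) * U x = of_real (\<theta> n (cis x)) * (K (cis x) * U x)"
          by eventually_elim (use \<open>sin x < 0\<close> in \<open>simp add: \<theta>_def min_def max_def\<close>)
        then show ?thesis using 2 by (intro Lim_transform_eventually[OF tendsto_const]) auto
      next
        case 3
        then show ?thesis by (simp add: \<theta>_def)
      next
        case 4
        then have "sin x \<ge> 0" by (intro sin_ge_zero) auto
        then show ?thesis using 4 by (simp add: \<theta>_def)
      qed
    qed
    show "(\<lambda>x. indicator {-pi<..<0} x * (K (cis x) * U x)) \<in> borel_measurable lebesgue"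
      by (rule borel_measurable_times[OF borel_measurable_indicator borel_measurable_integrable[OF KU]]) auto
    show "(\<lambda>x. of_real (\<theta> n (cis x)) * (K (cis x) * U x)) \<in> borel_measurable lebesgue" for n
      by (rule borel_measurable_times[OF \<theta>m borel_measurable_integrable[OF KU]])
  qed
  then show ?thesis unfolding zero using LIMSEQ_unique tendsto_const by blast
qed

section \<open>Size and scaling of the Abel kernel\<close>

lemma sin_ge_third:
  fixes x :: real
  assumes "0 \<le> x" "x \<le> pi / 2"
  shows "x / 3 \<le> sin x"
proof -
  have "\<bar>sin x - (\<Sum>m<3. sin_coeff m * x ^ m)\<bar> \<le> inverse (fact 3) * \<bar>x\<bar> ^ 3"
    by (rule Maclaurin_sin_bound)
  then have *: "\<bar>sin x - x\<bar> \<le> x ^ 3 / 6"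
    using assms by (simp add: numeral_3_eq_3 sin_coeff_def abs_minus_commute)
  \<comment> \<open>From x \<le> 2 the cubic error x^3 / 6 is at most 2 x / 3, leaving a third of
    x.\<close>
  have "x \<le> 2" using assms pi_less_4 by simp
  then have "x ^ 2 \<le> 2 ^ 2" using assms by (intro power_mono) auto
  then have "x ^ 2 * x \<le> 4 * x" using assms by (intro mult_right_mono) auto
  then have "x ^ 3 \<le> 4 * x" by (simp only: power3_eq_cube power2_eq_square)
  then show ?thesis using * by linarith
qed

text \<open>With r = exp(-e), |1 - r exp(ix)|^2 = (1-r)^2 + 4 r sin(x/2)^2. The bounds 1 - r \<ge>
  e/2, r \<ge> 1/3 and sin(x/2) \<ge> x/6 make this at least e^2/4 + x^2/27, while ((e+x)/8)^2 is at
  most (e^2 + x^2)/32. Uniformity in e is what allows domination after rescaling.\<close>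

lemma norm_one_minus_polar_ge:
  fixes e x :: real
  assumes "0 < e" "e \<le> 1" "0 \<le> x" "x \<le> pi"
  shows "(e + x) / 8 \<le> norm (1 - of_real (exp (- e)) * cis x)"
proof -
  define r where "r = exp (- e)"
  have "(norm (1 - of_real r * cis x))\<^sup>2 = (1 - r * cos x)\<^sup>2 + (r * sin x)\<^sup>2"
    by (simp add: cmod_power2)
  also have "\<dots> = 1 - 2 * r * cos x + r\<^sup>2 * ((sin x)\<^sup>2 + (cos x)\<^sup>2)"
    by algebra
  also have "\<dots> = 1 - 2 * r * cos x + r\<^sup>2" by simp
  also have "\<dots> = (1 - r)\<^sup>2 + 4 * r * (sin (x / 2))\<^sup>2"
  proof -
    have c: "cos x = 1 - 2 * (sin (x / 2))\<^sup>2" using cos_double_sin[of "x / 2"] by simp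
    show ?thesis unfolding c by algebra
  qed
  finally have n2: "(norm (1 - of_real r * cis x))\<^sup>2 = (1 - r)\<^sup>2 + 4 * r * (sin (x / 2))\<^sup>2" .
  have "1 + e \<le> exp e" by (rule exp_ge_add_one_self)
  then have "r \<le> 1 / (1 + e)"
    using le_imp_inverse_le[of "1 + e" "exp e"] assms unfolding r_def by (simp add: exp_minus inverse_eq_divide)
  then have "e / (1 + e) \<le> 1 - r" using assms by (simp add: field_simps)
  moreover have "e / 2 \<le> e / (1 + e)" using assms by (intro divide_left_mono) auto
  ultimately have "e / 2 \<le> 1 - r" by linarith
  then have "(e / 2)\<^sup>2 \<le> (1 - r)\<^sup>2" using assms by (intro power_mono) auto
  moreover have "1 / 3 \<le> r"
  proof -
    have "exp e \<le> exp 1" using assms by simp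
    then have "exp e \<le> 3" using exp_le by linarith
    then show ?thesis
      using le_imp_inverse_le[of "exp e" 3] unfolding r_def by (simp add: exp_minus inverse_eq_divide)
  qed
  moreover have "(x / 6)\<^sup>2 \<le> (sin (x / 2))\<^sup>2"
    using sin_ge_third[of "x / 2"] assms by (intro power_mono) auto
  then have "4 * (1 / 3) * (x / 6)\<^sup>2 \<le> 4 * r * (sin (x / 2))\<^sup>2"
    using \<open>1 / 3 \<le> r\<close> by (intro mult_mono) auto
  moreover have "((e + x) / 8)\<^sup>2 \<le> (e / 2)\<^sup>2 + 4 * (1 / 3) * (x / 6)\<^sup>2"
  proof -
    have "(e + x)\<^sup>2 \<le> 2 * e\<^sup>2 + 2 * x\<^sup>2"
      using sum_squares_bound[of e x] by (simp add: power2_sum)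
    moreover have "((e + x) / 8)\<^sup>2 = (e + x)\<^sup>2 / 64" "(e / 2)\<^sup>2 = e\<^sup>2 / 4" "(x / 6)\<^sup>2 = x\<^sup>2 / 36"
      by (simp_all add: power_divide)
    ultimately show ?thesis using zero_le_power2[of e] zero_le_power2[of x] by linarith
  qed
  ultimately have "((e + x) / 8)\<^sup>2 \<le> (norm (1 - of_real r * cis x))\<^sup>2" unfolding n2 by linarith
  then show ?thesis unfolding r_def by (rule power2_le_imp_le) simp
qed

text \<open>For e > 0, the sum of q^h over h \<ge> 1 with q = exp(-e + ix): the generating function
  of the Abel weights, starting at lag 1.\<close>

definition abel_kernel :: "real \<Rightarrow> real \<Rightarrow> complex" where
  "abel_kernel e x = of_real (exp (- e)) * cis x / (1 - of_real (exp (- e)) * cis x)"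

lemma norm_abel_kernel_le:
  assumes "0 < e" "e \<le> 1" "0 \<le> x" "x \<le> pi"
  shows "norm (abel_kernel e x) \<le> 8 / (e + x)"
proof -
  have "norm (abel_kernel e x) = exp (- e) / norm (1 - of_real (exp (- e)) * cis x)"
    by (simp add: abel_kernel_def norm_divide norm_mult)
  also have "\<dots> \<le> 1 / ((e + x) / 8)"
    by (rule frac_le) (use norm_one_minus_polar_ge[OF assms] assms in auto)
  finally show ?thesis by simp
qed

lemma abel_kernel_measurable [measurable]: "abel_kernel e \<in> borel_measurable borel"
proof -
  have [measurable]: "cis \<in> borel_measurable borel"
    by (intro borel_measurable_continuous_onI) (auto intro!: continuous_intros simp: cis_conv_exp)
  show ?thesis unfolding abel_kernel_def by measurable
qed

text \<open>Here q = exp(z/n) with z = -1 + i t, and n (q - 1) is a difference quotient of exp(h z)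
  at h = 0, which tends to z. Hence q / (n (1 - q)) tends to -1/z.\<close>

lemma abel_kernel_rescaled_tendsto:
  "(\<lambda>n. abel_kernel (1 / real n) (t / real n) / of_nat n) \<longlonglongrightarrow> 1 / (1 - \<i> * of_real t)"
proof -
  define z where "z = - 1 + \<i> * of_real t"
  have inv: "(\<lambda>n. of_real (1 / real n) :: complex) \<longlonglongrightarrow> 0"
    using tendsto_of_real[OF lim_inverse_n', where 'a = complex] by simp
  have "((\<lambda>h. exp (h * z)) has_field_derivative z) (at 0)"
    by (auto intro!: derivative_eq_intros)
  then have "((\<lambda>h. (exp (h * z) - 1) / h) \<longlongrightarrow> z) (at 0)"
    by (simp add: has_field_derivative_iff)
  moreover have "filterlim (\<lambda>n. of_real (1 / real n) :: complex) (at 0) sequentially"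
    by (rule filterlim_atI[OF inv]) (auto intro: eventually_mono[OF eventually_gt_at_top[of 0]])
  ultimately have "(\<lambda>n. (exp (of_real (1 / real n) * z) - 1) / of_real (1 / real n)) \<longlonglongrightarrow> z"
    by (rule filterlim_compose)
  moreover have "(\<lambda>n. exp (of_real (1 / real n) * z)) \<longlonglongrightarrow> exp (0 * z)"
    by (intro tendsto_intros inv)
  moreover have "z \<noteq> 0" by (simp add: z_def complex_eq_iff)
  ultimately have "(\<lambda>n. exp (of_real (1 / real n) * z) / - ((exp (of_real (1 / real n) * z) - 1) / of_real (1 / real n)))
      \<longlonglongrightarrow> exp (0 * z) / - z"
    by (intro tendsto_divide tendsto_minus) auto
  \<comment> \<open>The identity holds at n = 0 too, where division by zero makes both sides
    0.\<close>
  moreover have "exp (of_real (1 / real n) * z) / - ((exp (of_real (1 / real n) * z) - 1) / of_real (1 / real n))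
      = abel_kernel (1 / real n) (t / real n) / of_nat n" for n
  proof -
    have "of_real (exp (- (1 / real n))) * cis (t / real n) = exp (of_real (1 / real n) * z)"
      unfolding cis_conv_exp exp_of_real[symmetric] exp_add[symmetric] z_def
      by (rule arg_cong[of _ _ exp]) (simp add: algebra_simps)
    moreover have "e / - ((e - 1) / of_real (1 / real n)) = e / (1 - e) / of_nat n" for e :: complex
    proof -
      have "- ((e - 1) / of_real (1 / real n)) = (1 - e) * of_nat n" by (simp add: algebra_simps)
      then show ?thesis by simp
    qed
    ultimately show ?thesis by (simp only: abel_kernel_def)
  qed
  ultimately show ?thesis by (simp add: z_def)
qed

text \<open>Rationalising, 1 / (1 - i t) = (1 + i t) / (1 + t^2). Real and imaginary parts are the
  Mellin integrals with exponents -s and 1 - s, both inside (-1,1).\<close>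

lemma integral_power_over_one_minus_ii:
  fixes s :: real
  assumes s: "0 < s" "s < 1"
  shows "(\<integral>t. indicator {0<..} t * (of_real (t powr (- s)) * (1 / (1 - \<i> * of_real t))) \<partial>lebesgue)
    = of_real (pi / 2) * (of_real (1 / cos (pi * s / 2)) + \<i> * of_real (1 / sin (pi * s / 2)))"
proof -
  define A where "A t = indicator {0<..} t * (t powr (- s) / (1 + t\<^sup>2))" for t :: real
  define B where "B t = indicator {0<..} t * (t powr (1 - s) / (1 + t\<^sup>2))" for t :: real
  have A: "integrable lborel A" "(\<integral>t. A t \<partial>lborel) = pi / (2 * cos (pi * (- s) / 2))"
    using mellin_inverse_one_plus_square[of "- s"] s
    unfolding A_def[abs_def] set_integrable_def set_lebesgue_integral_def by auto
  have B: "integrable lborel B" "(\<integral>t. B t \<partial>lborel) = pi / (2 * cos (pi * (1 - s) / 2))"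
    using mellin_inverse_one_plus_square[of "1 - s"] s
    unfolding B_def[abs_def] set_integrable_def set_lebesgue_integral_def by auto
  have eq: "indicator {0<..} t * (of_real (t powr (- s)) * (1 / (1 - \<i> * of_real t)))
      = complex_of_real (A t) + \<i> * of_real (B t)" for t
  proof (cases "t > 0")
    case True
    define D where "D = complex_of_real (1 + t\<^sup>2)"
    have "(1 - \<i> * of_real t) * (1 + \<i> * of_real t) = D"
      by (simp add: D_def complex_eq_iff power2_eq_square)
    moreover have "1 + t\<^sup>2 > 0" by (rule add_pos_nonneg) auto
    then have "D \<noteq> 0" unfolding D_def of_real_eq_0_iff by simp
    moreover have "1 - \<i> * of_real t \<noteq> 0" by (simp add: complex_eq_iff)
    ultimately have "1 / (1 - \<i> * of_real t) = (1 + \<i> * of_real t) / D"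
      by (subst frac_eq_eq) (auto simp: mult.commute)
    then have "1 / (1 - \<i> * of_real t) = (1 + \<i> * of_real t) / of_real (1 + t\<^sup>2)"
      by (simp only: D_def)
    moreover have "t powr (1 - s) = t * t powr (- s)" using True powr_add[of t 1 "- s"] by simp
    ultimately show ?thesis
      using True by (simp add: A_def B_def distrib_left add_divide_distrib mult_ac)
  qed (simp add: A_def B_def)
  have [measurable]: "A \<in> borel_measurable borel" "B \<in> borel_measurable borel"
    unfolding A_def B_def by measurable
  have "(\<integral>t. complex_of_real (A t) + \<i> * of_real (B t) \<partial>lebesgue)
      = (\<integral>t. complex_of_real (A t) + \<i> * of_real (B t) \<partial>lborel)"
    by (rule integral_completion) measurable
  also have "\<dots> = of_real (\<integral>t. A t \<partial>lborel) + \<i> * of_real (\<integral>t. B t \<partial>lborel)"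
    using A B by simp
  moreover have "cos (pi * (1 - s) / 2) = sin (pi * s / 2)"
    by (simp add: cos_diff right_diff_distrib diff_divide_distrib)
  ultimately show ?thesis using A B unfolding eq by (simp add: distrib_left mult_ac)
qed

text \<open>Split at \<delta>. On [\<delta>, pi) the kernel is bounded uniformly in n, so that part
  is bounded and n^(-s) removes it. On (0, \<delta>) the function is bounded by a multiple of
  x^(-s), and x = t/n turns the integrand into one converging pointwise under an integrable
  majorant.\<close>

lemma abel_kernel_integral_scaled:
  fixes V :: "real \<Rightarrow> complex" and s :: real and c :: complex
  assumes s: "0 < s" "s < 1" and V: "integrable lebesgue V"
    and lim: "((\<lambda>x. V x / of_real (x powr (- s))) \<longlongrightarrow> c) (at_right 0)"
  shows "(\<lambda>n. of_real (real (Suc n) powr (- s)) *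
      (\<integral>x. indicator {0<..<pi} x * (abel_kernel (1 / real (Suc n)) x * V x) \<partial>lebesgue))
    \<longlonglongrightarrow> c * (of_real (pi / 2) * (of_real (1 / cos (pi * s / 2)) + \<i> * of_real (1 / sin (pi * s / 2))))"
proof -
  have [measurable]: "abel_kernel e \<in> borel_measurable lebesgue" for e
    by (rule measurable_completion) simp
  have Vm[measurable]: "V \<in> borel_measurable lebesgue" using V by simp
  have "\<forall>\<^sub>F x in at_right 0. dist (V x / of_real (x powr (- s))) c < 1"
    by (rule tendstoD[OF lim]) simp
  then obtain b where b: "b > 0" "\<And>x. 0 < x \<Longrightarrow> x < b \<Longrightarrow> dist (V x / of_real (x powr (- s))) c < 1"
    unfolding eventually_at_right_field by blast
  \<comment> \<open>The minimum with pi/2 keeps \<delta> inside (0, pi), where the kernel estimate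
    is valid.\<close>
  define \<delta> where "\<delta> = min b (pi / 2)"
  have \<delta>: "\<delta> > 0" "\<delta> < pi" using b by (auto simp: \<delta>_def min_def)
  have Vb: "norm (V x) \<le> (norm c + 1) * x powr (- s)" if "0 < x" "x < \<delta>" for x
  proof -
    have "norm (V x / of_real (x powr (- s))) \<le> norm c + 1"
      using b(2)[of x] that norm_triangle_ineq2[of "V x / of_real (x powr (- s))" c]
      by (simp add: \<delta>_def dist_norm)
    then show ?thesis using that by (simp add: norm_divide divide_le_eq)
  qed
  define G where "G n x = indicator {0<..<\<delta>} x * (abel_kernel (1 / real (Suc n)) x * V x)" for n x
  define H where "H n x = indicator {\<delta>..<pi} x * (abel_kernel (1 / real (Suc n)) x * V x)" for n x
  have Kb: "norm (abel_kernel (1 / real (Suc n)) x) \<le> 8 / (1 / real (Suc n) + x)" if "0 \<le> x" "x \<le> pi" for n x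
    by (rule norm_abel_kernel_le) (use that in auto)
  have Gi: "integrable lebesgue (G n)" for n
  proof (rule Bochner_Integration.integrable_bound)
    show "integrable lebesgue (\<lambda>x. 8 * real (Suc n) * norm (V x))" using V by simp
    show "G n \<in> borel_measurable lebesgue"
      unfolding G_def by (intro borel_measurable_times borel_measurable_indicator) auto
    show "AE x in lebesgue. norm (G n x) \<le> norm (8 * real (Suc n) * norm (V x))"
    proof (rule AE_I2)
      fix x :: real
      show "norm (G n x) \<le> norm (8 * real (Suc n) * norm (V x))"
      proof (cases "0 < x \<and> x < \<delta>")
        case True
        then have "8 / (1 / real (Suc n) + x) \<le> 8 / (1 / real (Suc n))"
          by (intro frac_le) auto
        then have "norm (abel_kernel (1 / real (Suc n)) x) \<le> 8 * real (Suc n)"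
          using Kb[of x n] True \<delta> by simp
        then have "norm (abel_kernel (1 / real (Suc n)) x) * norm (V x) \<le> 8 * real (Suc n) * norm (V x)"
          by (rule mult_right_mono) auto
        then show ?thesis using True by (simp add: G_def norm_mult)
      next
        case False
        then show ?thesis by (simp add: G_def)
      qed
    qed
  qed
  have Hb: "norm (H n x) \<le> 8 / \<delta> * norm (V x)" for n x
  proof (cases "\<delta> \<le> x \<and> x < pi")
    case True
    then have "8 / (1 / real (Suc n) + x) \<le> 8 / \<delta>"
      using \<delta> by (intro frac_le) (auto intro!: add_increasing)
    then have "norm (abel_kernel (1 / real (Suc n)) x) \<le> 8 / \<delta>"
      using Kb[of x n] True \<delta> by simp
    then have "norm (abel_kernel (1 / real (Suc n)) x) * norm (V x) \<le> 8 / \<delta> * norm (V x)"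
      by (rule mult_right_mono) auto
    then show ?thesis using True by (simp add: H_def norm_mult)
  next
    case False
    then show ?thesis using \<delta> by (simp add: H_def)
  qed
  have Hi: "integrable lebesgue (H n)" for n
  proof (rule Bochner_Integration.integrable_bound)
    show "integrable lebesgue (\<lambda>x. 8 / \<delta> * norm (V x))" using V by simp
    show "H n \<in> borel_measurable lebesgue"
      unfolding H_def by (intro borel_measurable_times borel_measurable_indicator) auto
    show "AE x in lebesgue. norm (H n x) \<le> norm (8 / \<delta> * norm (V x))"
      using Hb[of n] \<delta> by (intro AE_I2) simp
  qed
  have Hlim: "(\<lambda>n. of_real (real (Suc n) powr (- s)) * (\<integral>x. H n x \<partial>lebesgue)) \<longlonglongrightarrow> 0"
  proof (rule tendsto_norm_zero_cancel, rule tendsto_sandwich[OF _ _ tendsto_const])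
    define B where "B = (\<integral>x. 8 / \<delta> * norm (V x) \<partial>lebesgue)"
    have "(\<lambda>n. real (Suc n) powr (- s)) \<longlonglongrightarrow> 0"
      by (rule tendsto_neg_powr[OF _ filterlim_compose[OF filterlim_real_sequentially filterlim_Suc]])
         (use s in simp)
    from tendsto_mult[OF this tendsto_const[of B]]
    show "(\<lambda>n. real (Suc n) powr (- s) * B) \<longlonglongrightarrow> 0" by simp
    show "\<forall>\<^sub>F n in sequentially. norm (of_real (real (Suc n) powr (- s)) * (\<integral>x. H n x \<partial>lebesgue)) \<le> real (Suc n) powr (- s) * B"
    proof (rule always_eventually, rule allI)
      fix n
      have "norm (\<integral>x. H n x \<partial>lebesgue) \<le> (\<integral>x. norm (H n x) \<partial>lebesgue)" by (rule integral_norm_bound)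
      also have "\<dots> \<le> B" unfolding B_def by (rule integral_mono) (use Hi V Hb in auto)
      finally show "norm (of_real (real (Suc n) powr (- s)) * (\<integral>x. H n x \<partial>lebesgue)) \<le> real (Suc n) powr (- s) * B"
        by (simp add: norm_mult mult_left_mono)
    qed
  qed auto
  \<comment> \<open>The extra factor 1 / \<open>Suc n\<close> is the Jacobian of x = t /
    \<open>Suc n\<close>.\<close>
  define F where "F n t = of_real (real (Suc n) powr (- s) / real (Suc n)) * G n (t / real (Suc n))" for n t
  define J where "J t = indicator {0<..} t * (of_real (t powr (- s)) * (1 / (1 - \<i> * of_real t)))" for t :: real
  \<comment> \<open>This is 8 (|c| + 1) t^(-s) / (1 + t), with exponents spelled as in the Beta
    integral with parameters 1 - s and s. The denominator comes from the kernel bound, since 8 /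
    (1/N + t/N) = 8 N / (1 + t).\<close>
  define W where "W t = 8 * (norm c + 1) * (indicator {0<..} t * (t powr (1 - s - 1) * (1 + t) powr (- (1 - s) - s)))" for t :: real
  have FG: "(\<integral>t. F n t \<partial>lebesgue) = of_real (real (Suc n) powr (- s)) * (\<integral>x. G n x \<partial>lebesgue)" for n
    using lebesgue_integral_real_affine[of "1 / real (Suc n)" "G n" 0]
    unfolding F_def[abs_def] integral_mult_right_zero by (simp add: scaleR_conv_of_real)
  have Fm: "F n \<in> borel_measurable lebesgue" for n
    using lebesgue_integrable_real_affine[OF Gi[of n], of "1 / real (Suc n)" 0]
    unfolding F_def by (intro borel_measurable_times) auto
  have Wi: "integrable lebesgue W"
  proof -
    have "set_integrable lborel {0<..} (\<lambda>t. t powr (1 - s - 1) * (1 + t) powr (- (1 - s) - s))"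
      by (rule beta_integral_half_line) (use s in auto)
    then have "integrable lborel W"
      unfolding W_def[abs_def] set_integrable_def real_scaleR_def by (intro integrable_mult_right)
    then show ?thesis by (subst integrable_completion) (auto simp: W_def)
  qed
  have Fb: "norm (F n t) \<le> W t" for n t
  proof (cases "0 < t \<and> t < \<delta> * real (Suc n)")
    case True
    define N where "N = real (Suc n)"
    have N: "N > 0" "0 < t / N" "t / N < \<delta>" using True by (auto simp: N_def field_simps)
    have k: "norm (abel_kernel (1 / N) (t / N)) \<le> 8 * (N / (1 + t))"
      using Kb[of "t / N" n] N \<delta> True unfolding N_def[symmetric]
      by (simp add: add_divide_distrib[symmetric])
    have v: "norm (V (t / N)) \<le> (norm c + 1) * (N powr s * t powr (- s))"
      using Vb[OF N(2,3)] N True by (simp add: powr_divide powr_minus field_simps)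
    have "norm (F n t) = N powr (- s) / N * (norm (abel_kernel (1 / N) (t / N)) * norm (V (t / N)))"
      using N unfolding F_def G_def N_def[symmetric] by (simp add: norm_mult norm_divide)
    also have "\<dots> \<le> N powr (- s) / N * ((8 * (N / (1 + t))) * ((norm c + 1) * (N powr s * t powr (- s))))"
      using N by (intro mult_left_mono mult_mono k v) (use True in auto)
    also have "\<dots> = (N powr (- s) * N powr s) * (8 * (norm c + 1) * (t powr (- s) / (1 + t)))"
    proof -
      have "a / N * ((8 * (N / u)) * (C * (b * w))) = (a * b) * (8 * C * (w / u))" for a b u w C :: real
        using N by simp
      then show ?thesis .
    qed
    also have "N powr (- s) * N powr s = 1" using N by (simp flip: powr_add)
    also have "8 * (norm c + 1) * (t powr (- s) / (1 + t)) = W t"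
      using True by (simp add: W_def powr_minus divide_inverse)
    finally show ?thesis by simp
  next
    case False
    then have "t / real (Suc n) \<notin> {0<..<\<delta>}" by (auto simp: field_simps)
    then have "F n t = 0" by (simp add: F_def G_def)
    moreover have "W t \<ge> 0" by (simp add: W_def)
    ultimately show ?thesis by simp
  qed
  have Fconv: "(\<lambda>n. F n t) \<longlonglongrightarrow> c * J t" for t
  proof (cases "t > 0")
    case True
    have tn: "(\<lambda>n. t / real n) \<longlonglongrightarrow> 0"
      using tendsto_mult[OF tendsto_const[of t] lim_inverse_n'] by simp
    have ev: "\<forall>\<^sub>F n in sequentially. 0 < n \<and> t / real n < \<delta>"
      using order_tendstoD(2)[OF tn \<delta>(1)] eventually_gt_at_top[of 0] by eventually_elim auto
    have "filterlim (\<lambda>n. t / real n) (at_right 0) sequentially"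
      by (rule tendsto_imp_filterlim_at_right[OF tn])
         (use True in \<open>auto intro: eventually_mono[OF eventually_gt_at_top[of 0]]\<close>)
    from filterlim_compose[OF lim this]
    have "(\<lambda>n. V (t / real n) / of_real ((t / real n) powr (- s))) \<longlonglongrightarrow> c" .
    from tendsto_mult[OF tendsto_mult[OF this abel_kernel_rescaled_tendsto[of t]] tendsto_const[of "of_real (t powr (- s))"]]
    have "(\<lambda>n. V (t / real n) / of_real ((t / real n) powr (- s)) * (abel_kernel (1 / real n) (t / real n) / of_nat n) * of_real (t powr (- s)))
        \<longlonglongrightarrow> c * (1 / (1 - \<i> * of_real t)) * of_real (t powr (- s))" .
    moreover have "\<forall>\<^sub>F n in sequentially. V (t / real n) / of_real ((t / real n) powr (- s)) * (abel_kernel (1 / real n) (t / real n) / of_nat n) * of_real (t powr (- s))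
       = of_real (real n powr (- s) / real n) * (indicator {0<..<\<delta>} (t / real n) * (abel_kernel (1 / real n) (t / real n) * V (t / real n)))"
      using ev
    proof eventually_elim
      case (elim n)
      have "t powr (- s) = (t / real n) powr (- s) * real n powr (- s)"
        using True elim by (simp add: powr_divide)
      then have "complex_of_real (t powr (- s)) = of_real ((t / real n) powr (- s)) * of_real (real n powr (- s))"
        by (simp only: of_real_mult)
      moreover have "complex_of_real ((t / real n) powr (- s)) \<noteq> 0" using True elim by simp
      then have "v / of_real ((t / real n) powr (- s)) * (k / of_nat n) * (of_real ((t / real n) powr (- s)) * w)
          = w / of_nat n * (k * v)" for v k w :: complex
        by simp
      ultimately show ?case using elim True by simp
    qed
    ultimately have "(\<lambda>n. of_real (real n powr (- s) / real n) * (indicator {0<..<\<delta>} (t / real n) * (abel_kernel (1 / real n) (t / real n) * V (t / real n))))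
        \<longlonglongrightarrow> c * (1 / (1 - \<i> * of_real t)) * of_real (t powr (- s))"
      by (rule Lim_transform_eventually)
    from LIMSEQ_Suc[OF this] show ?thesis
      using True unfolding F_def G_def J_def by (simp add: mult_ac)
  next
    case False
    then have "F n t = 0" for n by (auto simp: F_def G_def zero_less_divide_iff)
    then show ?thesis using False by (simp add: J_def)
  qed
  have "(\<lambda>n. \<integral>t. F n t \<partial>lebesgue) \<longlonglongrightarrow> (\<integral>t. c * J t \<partial>lebesgue)"
  proof (rule integral_dominated_convergence[OF _ _ Wi])
    have "J \<in> borel_measurable borel" unfolding J_def by measurable
    then have "J \<in> borel_measurable lebesgue" by (intro measurable_completion) simp
    then show "(\<lambda>t. c * J t) \<in> borel_measurable lebesgue" by simp
  qed (use Fm Fb Fconv in auto)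
  from tendsto_add[OF this Hlim]
  have "(\<lambda>n. of_real (real (Suc n) powr (- s)) * ((\<integral>x. G n x \<partial>lebesgue) + (\<integral>x. H n x \<partial>lebesgue)))
      \<longlonglongrightarrow> c * (\<integral>t. J t \<partial>lebesgue)"
    unfolding FG by (simp add: distrib_left)
  also have "(\<lambda>n. of_real (real (Suc n) powr (- s)) * ((\<integral>x. G n x \<partial>lebesgue) + (\<integral>x. H n x \<partial>lebesgue)))
      = (\<lambda>n. of_real (real (Suc n) powr (- s)) *
      (\<integral>x. indicator {0<..<pi} x * (abel_kernel (1 / real (Suc n)) x * V x) \<partial>lebesgue))"
  proof
    fix n
    have "(\<integral>x. G n x \<partial>lebesgue) + (\<integral>x. H n x \<partial>lebesgue) = (\<integral>x. G n x + H n x \<partial>lebesgue)"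
      using Gi Hi by simp
    also have "(\<lambda>x. G n x + H n x) = (\<lambda>x. indicator {0<..<pi} x * (abel_kernel (1 / real (Suc n)) x * V x))"
      using \<delta> by (auto simp: G_def H_def indicator_def)
    finally show "of_real (real (Suc n) powr (- s)) * ((\<integral>x. G n x \<partial>lebesgue) + (\<integral>x. H n x \<partial>lebesgue))
      = of_real (real (Suc n) powr (- s)) *
      (\<integral>x. indicator {0<..<pi} x * (abel_kernel (1 / real (Suc n)) x * V x) \<partial>lebesgue)" by simp
  qed
  finally show ?thesis
    unfolding J_def integral_power_over_one_minus_ii[OF s] .
qed

section \<open>Abel sums as integrals over half a period\<close>

lemma cis_mult_integrable:
  assumes "integrable lebesgue V"
  shows "integrable lebesgue (\<lambda>x. cis (a * x) * V x)"
proof (rule integrable_mult_bounded[OF assms, of _ 1])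
  show "(\<lambda>x. cis (a * x)) \<in> borel_measurable lebesgue"
    by (intro borel_measurable_lebesgue_of_borel borel_measurable_continuous_onI)
       (auto intro!: continuous_intros simp: cis_conv_exp)
qed simp

text \<open>Since exp(-e) < 1, the L1 norms of the terms form a geometric series, so the expansion
  of the kernel may be integrated term by term.\<close>

lemma abel_sum_eq_integral:
  fixes V :: "real \<Rightarrow> complex" and \<gamma> :: "int \<Rightarrow> real"
  assumes V: "integrable lebesgue V"
    and \<gamma>: "\<And>h::int. (\<integral>x. cis (of_int h * x) * V x \<partial>lebesgue) = of_real (\<gamma> h)"
    and e: "e > 0"
  shows "of_real (\<Sum>k. exp (- ((real k + 1) * e)) * \<gamma> (int k + 1)) = (\<integral>x. abel_kernel e x * V x \<partial>lebesgue)"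
proof -
  define r where "r = exp (- e)"
  have r: "0 < r" "r < 1" using e by (auto simp: r_def)
  have pow: "exp (- ((real k + 1) * e)) = r * r ^ k" for k
    unfolding r_def exp_of_nat_mult[symmetric] exp_add[symmetric] by (simp add: algebra_simps)
  define f where "f k x = of_real (r * r ^ k) * (cis (of_int (int k + 1) * x) * V x)" for k x
  have fi: "integrable lebesgue (f k)" for k
    unfolding f_def[abs_def] by (intro integrable_mult_right cis_mult_integrable V)
  have fint: "(\<integral>x. f k x \<partial>lebesgue) = of_real (exp (- ((real k + 1) * e)) * \<gamma> (int k + 1))" for k
    unfolding f_def integral_mult_right_zero \<gamma> pow by simp
  have nf: "norm (f k x) = r ^ k * (r * norm (V x))" for k x
    using r by (simp add: f_def norm_mult norm_power)
  have fsum: "(\<lambda>k. f k x) sums (abel_kernel e x * V x)" for x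
  proof -
    define q where "q = of_real r * cis x"
    have "norm q < 1" using r by (simp add: q_def norm_mult)
    then have "(\<lambda>k. q ^ k) sums (1 / (1 - q))" by (rule geometric_sums)
    then have "(\<lambda>k. q ^ k * (q * V x)) sums (1 / (1 - q) * (q * V x))" by (rule sums_mult2)
    moreover have "q ^ k * (q * V x) = f k x" for k
    proof -
      have "cis (of_int (int k + 1) * x) = cis x ^ k * cis x"
      proof -
        have "cis x ^ k * cis x = cis (real k * x + x)" by (simp only: Complex.DeMoivre cis_mult)
        also have "real k * x + x = of_int (int k + 1) * x" by (simp add: algebra_simps)
        finally show ?thesis ..
      qed
      then show ?thesis by (simp add: f_def q_def power_mult_distrib mult_ac)
    qed
    moreover have "1 / (1 - q) * (q * V x) = abel_kernel e x * V x"
      by (simp add: abel_kernel_def q_def r_def)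
    ultimately show ?thesis by simp
  qed
  have s1: "AE x in lebesgue. summable (\<lambda>k. norm (f k x))"
    unfolding nf using r by (intro AE_I2 summable_mult2 summable_geometric) auto
  have s2: "summable (\<lambda>k. \<integral>x. norm (f k x) \<partial>lebesgue)"
    unfolding nf integral_mult_right_zero using r by (intro summable_mult2 summable_geometric) auto
  have "(\<lambda>k. \<integral>x. f k x \<partial>lebesgue) sums (\<integral>x. (\<Sum>k. f k x) \<partial>lebesgue)"
    by (rule sums_integral[OF fi s1 s2])
  then have "(\<lambda>k. complex_of_real (exp (- ((real k + 1) * e)) * \<gamma> (int k + 1))) sums (\<integral>x. abel_kernel e x * V x \<partial>lebesgue)"
    unfolding fint by (simp only: sums_unique[OF fsum, symmetric])
  \<comment> \<open>Summability of the real series ensures that its \<open>suminf\<close> is the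
    actual sum.\<close>
  moreover from this have "summable (\<lambda>k. exp (- ((real k + 1) * e)) * \<gamma> (int k + 1))"
    using summable_Re[OF sums_summable] by fastforce
  then have "(\<lambda>k. complex_of_real (exp (- ((real k + 1) * e)) * \<gamma> (int k + 1))) sums
      of_real (\<Sum>k. exp (- ((real k + 1) * e)) * \<gamma> (int k + 1))"
    by (intro sums_of_real summable_sums)
  ultimately show ?thesis by (rule sums_unique2[symmetric])
qed

lemma abel_kernel_minus: "abel_kernel e (- x) = cnj (abel_kernel e x)"
  by (simp add: abel_kernel_def cis_cnj)

text \<open>Real Fourier coefficients force \<open>V (- x) = cnj (V x)\<close> almost everywhere.\<close>

lemma abel_kernel_integral_half:
  fixes V :: "real \<Rightarrow> complex" and \<gamma> :: "int \<Rightarrow> real"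
  assumes V: "integrable lebesgue V" and supp: "\<And>x. x \<notin> {-pi..pi} \<Longrightarrow> V x = 0"
    and \<gamma>: "\<And>h::int. (\<integral>x. cis (of_int h * x) * V x \<partial>lebesgue) = of_real (\<gamma> h)"
    and e: "e > 0"
  shows "(\<integral>x. abel_kernel e x * V x \<partial>lebesgue)
    = of_real (2 * Re (\<integral>x. indicator {0<..<pi} x * (abel_kernel e x * V x) \<partial>lebesgue))"
proof -
  define r where "r = exp (- e)"
  have r: "0 < r" "r < 1" using e by (auto simp: r_def)
  \<comment> \<open>The kernel as a function of the point z = exp(ix); its pole 1/r lies outside the
    closed unit disc, so it is continuous on the circle.\<close>
  define K where "K z = of_real r * z / (1 - of_real r * z)" for z :: complex
  have den: "1 - of_real r * z \<noteq> 0" if "z \<in> sphere 0 1" for z :: complex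
  proof
    assume "1 - of_real r * z = 0"
    then have "norm (of_real r * z) = norm (1 :: complex)" by simp
    then show False using that r by (simp add: norm_mult)
  qed
  have Kc: "continuous_on (sphere 0 1) K"
    unfolding K_def by (intro continuous_intros) (use den in auto)
  have Kk: "K (cis x) = abel_kernel e x" for x by (simp add: K_def abel_kernel_def r_def)
  have "bounded (K ` sphere 0 1)"
    by (rule compact_imp_bounded[OF compact_continuous_image[OF Kc compact_sphere]])
  then obtain B where "\<forall>y\<in>K ` sphere 0 1. norm y \<le> B" unfolding bounded_iff by blast
  then have B: "norm (abel_kernel e x) \<le> B" for x unfolding Kk[symmetric] by auto
  have km: "abel_kernel e \<in> borel_measurable lebesgue"
    by (rule borel_measurable_lebesgue_of_borel) simp
  have KV: "integrable lebesgue (\<lambda>x. abel_kernel e x * W x)" if "integrable lebesgue W" for W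
    by (rule integrable_mult_bounded[OF that km B])
  have ind: "integrable lebesgue (\<lambda>x. indicator S x * W x)"
    if "integrable lebesgue W" "S \<in> sets lebesgue" for W :: "real \<Rightarrow> complex" and S
    by (rule integrable_mult_bounded[OF that(1), of _ 1]) (use that in \<open>auto simp: indicator_def\<close>)
  have reflect: "integrable lebesgue (\<lambda>x. W (- x))" "(\<integral>x. W (- x) \<partial>lebesgue) = (\<integral>x. W x \<partial>lebesgue)"
    if "integrable lebesgue W" for W :: "real \<Rightarrow> complex"
    using lebesgue_integrable_real_affine[OF that, of "-1" 0] lebesgue_integral_real_affine[of "-1" W 0] by auto
  \<comment> \<open>The defect of Hermitian symmetry. Reflecting and conjugating \<open>V\<close>
    conjugates its coefficients, which are real, so all coefficients of \<open>U\<close>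
    vanish.\<close>
  define U where "U x = V x - cnj (V (- x))" for x
  have V': "integrable lebesgue (\<lambda>x. cnj (V (- x)))" using reflect(1)[OF V] by simp
  have Ui: "integrable lebesgue U" unfolding U_def[abs_def] using V V' by simp
  have U0: "(\<integral>x. cis (of_int h * x) * U x \<partial>lebesgue) = 0" for h :: int
  proof -
    have "(\<integral>x. cis (of_int h * x) * cnj (V (- x)) \<partial>lebesgue) = cnj (\<integral>x. cis (of_int h * (- x)) * V (- x) \<partial>lebesgue)"
    proof -
      have "cis (of_int h * x) * cnj (V (- x)) = cnj (cis (of_int h * (- x)) * V (- x))" for x
        by (simp add: cis_cnj)
      then show ?thesis by (simp only: Bochner_Integration.integral_cnj)
    qed
    also have "\<dots> = cnj (of_real (\<gamma> h))"
      unfolding \<gamma>[symmetric] by (subst reflect(2)[OF cis_mult_integrable[OF V]]) simp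
    finally show ?thesis
      unfolding U_def right_diff_distrib
      by (subst Bochner_Integration.integral_diff) (use cis_mult_integrable V V' \<gamma> in auto)
  qed
  define I where "I = (\<integral>x. indicator {0<..<pi} x * (abel_kernel e x * V x) \<partial>lebesgue)"
  define N where "N = (\<integral>x. indicator {-pi<..<0} x * (abel_kernel e x * V x) \<partial>lebesgue)"
  have "(\<integral>x. indicator {-pi<..<0} x * (K (cis x) * U x) \<partial>lebesgue) = 0"
    by (rule fourier_zero_half_circle[OF Kc Ui U0]) (use supp in \<open>auto simp: U_def\<close>)
  moreover have "(\<integral>x. indicator {-pi<..<0} x * (K (cis x) * U x) \<partial>lebesgue)
      = N - (\<integral>x. indicator {-pi<..<0} x * (abel_kernel e x * cnj (V (- x))) \<partial>lebesgue)"
    unfolding Kk U_def right_diff_distrib N_def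
    by (rule Bochner_Integration.integral_diff) (intro ind KV V V'; simp)+
  moreover have "(\<integral>x. indicator {-pi<..<0} x * (abel_kernel e x * cnj (V (- x))) \<partial>lebesgue) = cnj I"
  proof -
    \<comment> \<open>Conjugate symmetry of the kernel makes the integrand on the negative half the
      conjugate of the reflected integrand on the positive half.\<close>
    have "(\<lambda>x. indicator {-pi<..<0} x * (abel_kernel e x * cnj (V (- x))))
        = (\<lambda>x. cnj (indicator {0<..<pi} (- x) * (abel_kernel e (- x) * V (- x))))"
    proof
      show "indicator {-pi<..<0} x * (abel_kernel e x * cnj (V (- x)))
        = cnj (indicator {0<..<pi} (- x) * (abel_kernel e (- x) * V (- x)))" for x
        by (cases "- pi < x \<and> x < 0") (auto simp: abel_kernel_minus)
    qed
    moreover have "(\<integral>x. indicator {0<..<pi} (- x) * (abel_kernel e (- x) * V (- x)) \<partial>lebesgue) = I"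
      unfolding I_def by (rule reflect(2)[OF ind[OF KV[OF V]]]) simp
    ultimately show ?thesis by (simp del: complex_cnj_mult)
  qed
  ultimately have N: "N = cnj I" by simp
  have "(\<integral>x. abel_kernel e x * V x \<partial>lebesgue) = (\<integral>x. indicator {0<..<pi} x * (abel_kernel e x * V x)
      + indicator {-pi<..<0} x * (abel_kernel e x * V x) \<partial>lebesgue)"
  proof (rule integral_cong_AE)
    have "AE x in lborel. x \<noteq> (a :: real)" for a by (rule AE_lborel_singleton)
    then have "AE x in lborel. x \<noteq> 0 \<and> x \<noteq> pi \<and> x \<noteq> - pi" by simp
    then have "AE x in lebesgue. x \<noteq> 0 \<and> x \<noteq> pi \<and> x \<noteq> - pi" by (rule AE_completion)
    then show "AE x in lebesgue. abel_kernel e x * V x = indicator {0<..<pi} x * (abel_kernel e x * V x)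
      + indicator {-pi<..<0} x * (abel_kernel e x * V x)"
    proof eventually_elim
      case (elim x)
      then have "V x = 0 \<or> x \<in> {0<..<pi} \<or> x \<in> {-pi<..<0}" using supp[of x] by force
      then show ?case by auto
    qed
  qed (use KV[OF V] ind[OF KV[OF V]] in \<open>auto intro!: borel_measurable_add borel_measurable_integrable\<close>)
  also have "\<dots> = I + N" unfolding I_def N_def
    by (rule Bochner_Integration.integral_add) (intro ind KV V; simp)+
  also have "\<dots> = of_real (2 * Re I)" unfolding N by (rule complex_add_cnj)
  finally show ?thesis unfolding I_def .
qed

text \<open>The same rescaled Abel sums have two limits, which must agree. They see only the real
  part of c times the kernel integral, hence one real equation for a complex c; it determines c when
  c is real or purely imaginary, as every entry of the limiting spectral matrix is.\<close>

lemma spectral_tauberian: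
  fixes \<gamma> :: "int \<Rightarrow> real" and v :: "real \<Rightarrow> complex" and s b :: real and c :: complex
  assumes s: "0 < s" "s < 1"
    and v: "v absolutely_integrable_on {-pi..pi}"
    and fourier: "\<And>h::int. ((\<lambda>x. exp (\<i> * of_int h * of_real x) * v x) has_integral of_real (\<gamma> h)) {-pi..pi}"
    and \<gamma>: "((\<lambda>l. \<gamma> l / of_int l powr (s - 1)) \<longlongrightarrow> b) at_top"
    and lim: "((\<lambda>x. v x / of_real (x powr (- s))) \<longlongrightarrow> c) (at_right 0)"
  shows "b * Gamma s = pi * (Re c / cos (pi * s / 2) - Im c / sin (pi * s / 2))"
proof -
  \<comment> \<open>Extension by zero allows reflection and rescaling on the whole line.\<close>
  define V where "V x = indicator {-pi..pi} x *\<^sub>R v x" for x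
  have V: "integrable lebesgue V" using v by (simp add: V_def[abs_def] set_integrable_def)
  have supp: "V x = 0" if "x \<notin> {-pi..pi}" for x using that by (simp add: V_def)
  have Vf: "(\<integral>x. cis (of_int h * x) * V x \<partial>lebesgue) = of_real (\<gamma> h)" for h :: int
  proof -
    have eq: "cis (of_int h * x) * V x = indicator {-pi..pi} x *\<^sub>R (exp (\<i> * of_int h * of_real x) * v x)" for x
      by (simp add: V_def cis_conv_exp mult_ac)
    have "(\<lambda>x. exp (\<i> * of_int h * of_real x) * v x) absolutely_integrable_on {-pi..pi}"
      using cis_mult_integrable[OF V, of "of_int h"] unfolding eq set_integrable_def .
    then have "(\<integral>x. cis (of_int h * x) * V x \<partial>lebesgue) = integral {-pi..pi} (\<lambda>x. exp (\<i> * of_int h * of_real x) * v x)"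
      unfolding eq using set_lebesgue_integral_eq_integral(2) unfolding set_lebesgue_integral_def by blast
    then show ?thesis using fourier[of h] by (simp add: integral_unique)
  qed
  have Vlim: "((\<lambda>x. V x / of_real (x powr (- s))) \<longlongrightarrow> c) (at_right 0)"
  proof (rule Lim_transform_eventually[OF lim])
    show "\<forall>\<^sub>F x in at_right 0. v x / of_real (x powr (- s)) = V x / of_real (x powr (- s))"
      unfolding eventually_at_right_field by (rule exI[of _ pi]) (auto simp: V_def)
  qed
  define I where "I = complex_of_real (pi / 2) * (of_real (1 / cos (pi * s / 2)) + \<i> * of_real (1 / sin (pi * s / 2)))"
  define J where "J n = (\<integral>x. indicator {0<..<pi} x * (abel_kernel (1 / real (Suc n)) x * V x) \<partial>lebesgue)" for n
  have "(\<lambda>n. 2 * Re (of_real (real (Suc n) powr (- s)) * J n)) \<longlonglongrightarrow> 2 * Re (c * I)"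
    unfolding J_def I_def by (intro tendsto_intros abel_kernel_integral_scaled[OF s V Vlim])
  moreover have "2 * Re (of_real (real (Suc n) powr (- s)) * J n)
      = real (Suc n) powr (- s) * (\<Sum>k. exp (- ((real k + 1) / real (Suc n))) * \<gamma> (int k + 1))" for n
  proof -
    have "complex_of_real (\<Sum>k. exp (- ((real k + 1) * (1 / real (Suc n)))) * \<gamma> (int k + 1)) = of_real (2 * Re (J n))"
      unfolding J_def
      by (subst abel_sum_eq_integral[OF V Vf]) (simp, rule abel_kernel_integral_half[OF V supp Vf], auto)
    then have "(\<Sum>k. exp (- ((real k + 1) / real (Suc n))) * \<gamma> (int k + 1)) = 2 * Re (J n)"
      unfolding of_real_eq_iff by simp
    then show ?thesis by (simp add: mult_ac)
  qed
  ultimately have "(\<lambda>n. real (Suc n) powr (- s) * (\<Sum>k. exp (- ((real k + 1) / real (Suc n))) * \<gamma> (int k + 1)))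
      \<longlonglongrightarrow> 2 * Re (c * I)" by (simp only:)
  with abel_sum_scaled[OF s \<gamma>] have "b * Gamma s = 2 * Re (c * I)" by (rule LIMSEQ_unique)
  also have "\<dots> = pi * (Re c / cos (pi * s / 2) - Im c / sin (pi * s / 2))"
    by (simp add: I_def algebra_simps)
  finally show ?thesis .
qed

section \<open>Evaluation of the constants\<close>

lemma mat_asymp_tendsto:
  fixes Q :: "'x \<Rightarrow> 'a::real_normed_field^'n^'m"
  assumes "mat_asymp F Q C \<rho>" "\<forall>\<^sub>F x in F. \<rho> x \<noteq> 0"
  shows "((\<lambda>x. Q x $ j $ k / of_real (\<rho> x)) \<longlongrightarrow> C $ j $ k) F"
proof -
  have "(\<lambda>x. Q x $ j $ k - C $ j $ k * of_real (\<rho> x)) \<in> o[F](\<lambda>x. of_real (\<rho> x))"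
    using assms(1) by (simp add: mat_asymp_def)
  then have "((\<lambda>x. (Q x $ j $ k - C $ j $ k * of_real (\<rho> x)) / of_real (\<rho> x)) \<longlongrightarrow> 0) F"
    by (rule smalloD_tendsto)
  then have "((\<lambda>x. (Q x $ j $ k - C $ j $ k * of_real (\<rho> x)) / of_real (\<rho> x) + C $ j $ k) \<longlongrightarrow> 0 + C $ j $ k) F"
    by (intro tendsto_add tendsto_const)
  moreover have "\<forall>\<^sub>F x in F. (Q x $ j $ k - C $ j $ k * of_real (\<rho> x)) / of_real (\<rho> x) + C $ j $ k = Q x $ j $ k / of_real (\<rho> x)"
    using assms(2) by eventually_elim (simp add: diff_divide_distrib)
  ultimately show ?thesis by (simp add: tendsto_cong)
qed

lemma Beta_self_eq: "d > 0 \<Longrightarrow> Beta d d = (Gamma d)\<^sup>2 / Gamma (2 * d)" for d :: real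
  by (simp add: Beta_def power2_eq_square)

text \<open>Reflection at 2d and at d rewrites Gamma(1-2d) and Gamma(1-d). In the quotient sin(2 pi
  d) = 2 sin(pi d) cos(pi d) cancels the sine and leaves the factor 2 and the cosine.\<close>

lemma Beta_one_minus_double:
  fixes d :: real
  assumes d: "0 < d" "d < 1 / 2"
  shows "2 * Beta d (1 - 2 * d) = (Gamma d)\<^sup>2 / Gamma (2 * d) * (1 / cos (pi * d))"
proof -
  have pd: "0 < pi * d" "pi * d < pi / 2" using d by auto
  have sc: "sin (pi * d) > 0" "cos (pi * d) > 0"
    using pd by (auto intro!: sin_gt_zero cos_gt_zero)
  have G: "Gamma d > 0" "Gamma (2 * d) > 0" "Gamma (1 - d) > 0"
    using d by (auto intro!: Gamma_real_pos)
  have "Gamma (1 - 2 * d) = pi / sin (pi * (2 * d)) / Gamma (2 * d)"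
    using Gamma_reflection_real[of "2 * d"] G(2) by (subst nonzero_eq_divide_eq) (auto simp: mult.commute)
  also have "sin (pi * (2 * d)) = 2 * sin (pi * d) * cos (pi * d)"
    using sin_double[of "pi * d"] by (simp add: mult_ac)
  finally have 1: "Gamma (1 - 2 * d) = pi / (2 * sin (pi * d) * cos (pi * d)) / Gamma (2 * d)" .
  have 2: "Gamma (1 - d) = pi / sin (pi * d) / Gamma d"
    using Gamma_reflection_real[of d] G(1) by (subst nonzero_eq_divide_eq) (auto simp: mult.commute)
  have "Beta d (1 - 2 * d) = Gamma d * Gamma (1 - 2 * d) / Gamma (1 - d)"
    by (simp add: Beta_def)
  then show ?thesis unfolding 1 2 using sc G by (simp add: field_simps power2_eq_square)
qed

theorem proposition3p1:
  fixes M :: "'w measure"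
    and \<epsilon> Y :: "int \<Rightarrow> 'w \<Rightarrow> real^2"
    and A :: "int \<Rightarrow> real^2^2" and Ap Am :: "real^2^2"
    and \<alpha>\<^sub>0 \<alpha>\<^sub>1 :: "int \<Rightarrow> real"
    and f :: "real \<Rightarrow> complex^2^2"
    and d a\<^sub>0 a\<^sub>1 r\<^sub>0 r\<^sub>1 g\<^sub>0 g\<^sub>1 :: real
  assumes "prob_space M"
    and "0 < d" and "d < 1/2"
    and "white_noise M \<epsilon>"
    and "\<And>l. A l = mat22 (\<alpha>\<^sub>0 l) (\<alpha>\<^sub>1 l) (- \<alpha>\<^sub>1 l) (\<alpha>\<^sub>0 l)"
    and "linear_process M A \<epsilon> Y"
    and "Ap = mat22 a\<^sub>0 a\<^sub>1 (- a\<^sub>1) a\<^sub>0" and "Ap = transpose Am"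
    and "mat_asymp at_top A Ap (\<lambda>l. real_of_int l powr (d - 1))"
    and "mat_asymp at_bot A Am (\<lambda>l. real_of_int (- l) powr (d - 1))"
    and "mat_asymp at_top (autocov M Y) (mat22 r\<^sub>0 (- r\<^sub>1) r\<^sub>1 r\<^sub>0)
           (\<lambda>h. real_of_int h powr (2 * d - 1))"
    and "is_spectral_density (autocov M Y) f"
    and "mat_asymp (at_right 0) f
           (mat22 (of_real g\<^sub>0) (\<i> * of_real g\<^sub>1) (- \<i> * of_real g\<^sub>1) (of_real g\<^sub>0))
           (\<lambda>x. x powr (- 2 * d))"
  shows "r\<^sub>0 = (Gamma d)\<^sup>2 / Gamma (2 * d) *
            ((a\<^sub>0\<^sup>2 + a\<^sub>1\<^sup>2) * (1 / cos (pi * d)) + (a\<^sub>0\<^sup>2 - a\<^sub>1\<^sup>2)) \<and>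
         r\<^sub>1 = - 2 * a\<^sub>0 * a\<^sub>1 * ((Gamma d)\<^sup>2 / Gamma (2 * d)) \<and>
         g\<^sub>0 = Gamma (2 * d) / pi * cos (pi * d) * r\<^sub>0 \<and>
         g\<^sub>1 = Gamma (2 * d) / pi * sin (pi * d) * r\<^sub>1"
proof -
  note d = \<open>0 < d\<close> \<open>d < 1/2\<close>
  have mat22_simps: "mat22 p q r s $ 1 $ 1 = p" "mat22 p q r s $ 1 $ 2 = q"
    "mat22 p q r s $ 2 $ 1 = r" "mat22 p q r s $ 2 $ 2 = s" for p q r s :: "'z::zero"
    by (simp_all add: vector_2)
  have A: "A l $ 1 $ 1 = \<alpha>\<^sub>0 l" "A l $ 1 $ 2 = \<alpha>\<^sub>1 l" "A l $ 2 $ 1 = - \<alpha>\<^sub>1 l" "A l $ 2 $ 2 = \<alpha>\<^sub>0 l" for l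
    unfolding assms(5) by (simp_all only: mat22_simps)
  have Ap: "Ap $ 1 $ 1 = a\<^sub>0" "Ap $ 1 $ 2 = a\<^sub>1" "Ap $ 2 $ 1 = - a\<^sub>1"
    unfolding assms(7) by (simp_all only: mat22_simps)
  have "Am $ j $ k = Ap $ k $ j" for j k using assms(8) by (simp add: transpose_def)
  then have Am: "Am $ 1 $ 1 = a\<^sub>0" "Am $ 1 $ 2 = - a\<^sub>1" using Ap by simp_all
  have evtop: "\<forall>\<^sub>F l in at_top. real_of_int l powr e \<noteq> 0" for e
    by (rule eventually_mono[OF eventually_gt_at_top[of 0]]) simp
  have evbot: "\<forall>\<^sub>F l in at_bot. real_of_int (- l) powr e \<noteq> 0" for e
    by (rule eventually_mono[OF eventually_le_at_bot[of "- 1"]]) simp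
  have neg: "filterlim (uminus :: int \<Rightarrow> int) at_bot at_top"
    unfolding filterlim_at_bot
  proof
    show "\<forall>\<^sub>F l in at_top. - l \<le> Z" for Z :: int
      by (rule eventually_mono[OF eventually_ge_at_top[of "- Z"]]) simp
  qed
  have top: "((\<lambda>l. A l $ j $ k / real_of_int l powr (d - 1)) \<longlongrightarrow> Ap $ j $ k) at_top" for j k
    using mat_asymp_tendsto[OF assms(9) evtop, of j k] by simp
  have bot: "((\<lambda>l. A (- l) $ j $ k / real_of_int l powr (d - 1)) \<longlongrightarrow> Am $ j $ k) at_top" for j k
    using filterlim_compose[OF mat_asymp_tendsto[OF assms(10) evbot, of j k] neg] by simp
  \<comment> \<open>The transposition relating the limit matrices shows up here: the diagonal
    sequence has equal constants on both sides, the off-diagonal one opposite constants.\<close>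
  have p0: "two_sided_power (d - 1) \<alpha>\<^sub>0 a\<^sub>0 a\<^sub>0" and p1: "two_sided_power (d - 1) \<alpha>\<^sub>1 a\<^sub>1 (- a\<^sub>1)"
    unfolding two_sided_power_def using top[of 1 1] bot[of 1 1] top[of 1 2] bot[of 1 2]
    by (simp_all add: A Ap Am)
  define c where "c a b n = (\<integral>l. a (l + int n) * b l \<partial>count_space UNIV)" for a b :: "int \<Rightarrow> real" and n
  have int: "integrable (count_space UNIV) (\<lambda>l. a (l + int n) * b l)"
    if "n > 0" "a = \<alpha>\<^sub>0 \<or> a = \<alpha>\<^sub>1" "b = \<alpha>\<^sub>0 \<or> b = \<alpha>\<^sub>1" for a b n
    using that lattice_convolution(1)[OF d p0 p0] lattice_convolution(1)[OF d p0 p1]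
      lattice_convolution(1)[OF d p1 p0] lattice_convolution(1)[OF d p1 p1] by blast
  have intA: "integrable (count_space UNIV) (\<lambda>l. \<Sum>a\<in>UNIV. A (l + int n) $ j $ a * A l $ k $ a)"
    if "n > 0" for n j k
    using exhaust_2[of j] exhaust_2[of k] int[OF that] by (auto simp: sum_2 A)
  have cov: "autocov M Y (int n) $ j $ k = (\<integral>l. (\<Sum>a\<in>UNIV. A (l + int n) $ j $ a * A l $ k $ a) \<partial>count_space UNIV)"
    if "n > 0" for n j k
    by (rule autocov_linear_process[OF assms(4,6) intA[OF that]])
  \<comment> \<open>Entry (2,1) pairs the second row (-\<alpha>1, \<alpha>0) at l + n with the first
    row (\<alpha>0, \<alpha>1) at l, hence a difference of the two orders of convolution.\<close>
  have cov0: "autocov M Y (int n) $ 1 $ 1 = c \<alpha>\<^sub>0 \<alpha>\<^sub>0 n + c \<alpha>\<^sub>1 \<alpha>\<^sub>1 n"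
    and cov1: "autocov M Y (int n) $ 2 $ 1 = c \<alpha>\<^sub>0 \<alpha>\<^sub>1 n - c \<alpha>\<^sub>1 \<alpha>\<^sub>0 n" if "n > 0" for n
    unfolding cov[OF that] c_def using int[OF that] by (simp_all add: sum_2 A)
  define P where "P = Beta d (1 - 2 * d)"
  define B where "B = Beta d d"
  have conv: "(\<lambda>n. real n powr (1 - 2 * d) * c a b n) \<longlonglongrightarrow> (p * p' + m * m') * P + p * m' * B"
    if "two_sided_power (d - 1) a p m" "two_sided_power (d - 1) b p' m'" for a b p m p' m'
    unfolding c_def P_def B_def by (rule lattice_convolution(2)[OF d that])
  have gam: "((\<lambda>h. autocov M Y h $ j $ k / real_of_int h powr (2 * d - 1)) \<longlongrightarrow> mat22 r\<^sub>0 (- r\<^sub>1) r\<^sub>1 r\<^sub>0 $ j $ k) at_top" for j k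
    using mat_asymp_tendsto[OF assms(11) evtop, of j k] by simp
  have gam_nat: "(\<lambda>n. real n powr (1 - 2 * d) * autocov M Y (int n) $ j $ k) \<longlonglongrightarrow> mat22 r\<^sub>0 (- r\<^sub>1) r\<^sub>1 r\<^sub>0 $ j $ k" for j k
  proof -
    have "real n powr (1 - 2 * d) = 1 / real n powr (2 * d - 1)" for n
      using powr_minus_divide[of "real n" "2 * d - 1"] by simp
    then show ?thesis using filterlim_compose[OF gam[of j k] filterlim_int_sequentially] by simp
  qed
  have r0: "r\<^sub>0 = 2 * P * (a\<^sub>0\<^sup>2 + a\<^sub>1\<^sup>2) + B * (a\<^sub>0\<^sup>2 - a\<^sub>1\<^sup>2)"
  proof (rule LIMSEQ_unique)
    show "(\<lambda>n. real n powr (1 - 2 * d) * autocov M Y (int n) $ 1 $ 1) \<longlonglongrightarrow> r\<^sub>0"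
      using gam_nat[of 1 1] by (simp only: mat22_simps)
    have "(\<lambda>n. real n powr (1 - 2 * d) * c \<alpha>\<^sub>0 \<alpha>\<^sub>0 n + real n powr (1 - 2 * d) * c \<alpha>\<^sub>1 \<alpha>\<^sub>1 n)
        \<longlonglongrightarrow> 2 * P * (a\<^sub>0\<^sup>2 + a\<^sub>1\<^sup>2) + B * (a\<^sub>0\<^sup>2 - a\<^sub>1\<^sup>2)"
      using tendsto_add[OF conv[OF p0 p0] conv[OF p1 p1]] by (simp add: power2_eq_square algebra_simps)
    then show "(\<lambda>n. real n powr (1 - 2 * d) * autocov M Y (int n) $ 1 $ 1)
        \<longlonglongrightarrow> 2 * P * (a\<^sub>0\<^sup>2 + a\<^sub>1\<^sup>2) + B * (a\<^sub>0\<^sup>2 - a\<^sub>1\<^sup>2)"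
      by (rule Lim_transform_eventually)
         (auto intro!: eventually_mono[OF eventually_gt_at_top[of 0]] simp: cov0 distrib_left)
  qed
  \<comment> \<open>For an even and an odd sequence \<open>p * p' + m * m'\<close> is 0, so the
    outer pieces cancel in each convolution. The middle pieces have coefficients -a0 a1 and a1 a0 in
    the two orders, and their difference gives the factor -2.\<close>
  have r1: "r\<^sub>1 = - 2 * a\<^sub>0 * a\<^sub>1 * B"
  proof (rule LIMSEQ_unique)
    show "(\<lambda>n. real n powr (1 - 2 * d) * autocov M Y (int n) $ 2 $ 1) \<longlonglongrightarrow> r\<^sub>1"
      using gam_nat[of 2 1] by (simp only: mat22_simps)
    have "(\<lambda>n. real n powr (1 - 2 * d) * c \<alpha>\<^sub>0 \<alpha>\<^sub>1 n - real n powr (1 - 2 * d) * c \<alpha>\<^sub>1 \<alpha>\<^sub>0 n)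
        \<longlonglongrightarrow> - 2 * a\<^sub>0 * a\<^sub>1 * B"
      using tendsto_diff[OF conv[OF p0 p1] conv[OF p1 p0]] by (simp add: algebra_simps)
    then show "(\<lambda>n. real n powr (1 - 2 * d) * autocov M Y (int n) $ 2 $ 1) \<longlonglongrightarrow> - 2 * a\<^sub>0 * a\<^sub>1 * B"
      by (rule Lim_transform_eventually)
         (auto intro!: eventually_mono[OF eventually_gt_at_top[of 0]] simp: cov1 right_diff_distrib)
  qed
  have evright: "\<forall>\<^sub>F x in at_right 0. x powr (- 2 * d) \<noteq> (0::real)"
    unfolding eventually_at_right_field by (rule exI[of _ 1]) auto
  have spec: "mat22 r\<^sub>0 (- r\<^sub>1) r\<^sub>1 r\<^sub>0 $ j $ k * Gamma (2 * d) = pi * (Re C / cos (pi * d) - Im C / sin (pi * d))"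
    if "C = mat22 (of_real g\<^sub>0) (\<i> * of_real g\<^sub>1) (- \<i> * of_real g\<^sub>1) (of_real g\<^sub>0) $ j $ k" for C j k
  proof -
    have "mat22 r\<^sub>0 (- r\<^sub>1) r\<^sub>1 r\<^sub>0 $ j $ k * Gamma (2 * d)
        = pi * (Re C / cos (pi * (2 * d) / 2) - Im C / sin (pi * (2 * d) / 2))"
    proof (rule spectral_tauberian)
      show "0 < 2 * d" "2 * d < 1" using d by auto
      show "(\<lambda>x. f x $ j $ k) absolutely_integrable_on {-pi..pi}"
        using assms(12) by (simp add: is_spectral_density_def)
      show "((\<lambda>x. exp (\<i> * of_int h * of_real x) * f x $ j $ k) has_integral of_real (autocov M Y h $ j $ k)) {-pi..pi}" for h
        using assms(12) by (simp add: is_spectral_density_def)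
      show "((\<lambda>h. autocov M Y h $ j $ k / real_of_int h powr (2 * d - 1)) \<longlongrightarrow> mat22 r\<^sub>0 (- r\<^sub>1) r\<^sub>1 r\<^sub>0 $ j $ k) at_top"
        by (rule gam)
      show "((\<lambda>x. f x $ j $ k / of_real (x powr (- (2 * d)))) \<longlongrightarrow> C) (at_right 0)"
        using mat_asymp_tendsto[OF assms(13) evright, of j k] unfolding that by simp
    qed
    then show ?thesis by simp
  qed
  have pd: "0 < pi * d" "pi * d < pi / 2" using d by auto
  have sc: "sin (pi * d) > 0" "cos (pi * d) > 0"
    using pd by (auto intro!: sin_gt_zero cos_gt_zero)
  have "r\<^sub>0 * Gamma (2 * d) = pi * (g\<^sub>0 / cos (pi * d))"
    using spec[OF refl, of 1 1] unfolding mat22_simps by simp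
  then have g0: "g\<^sub>0 = Gamma (2 * d) / pi * cos (pi * d) * r\<^sub>0"
    using sc by (simp add: field_simps)
  \<comment> \<open>In entry (2,1) the spectral constant is -i g1; its negative imaginary part
    compensates the minus sign in the comparison.\<close>
  have "r\<^sub>1 * Gamma (2 * d) = pi * (g\<^sub>1 / sin (pi * d))"
    using spec[OF refl, of 2 1] unfolding mat22_simps by simp
  then have g1: "g\<^sub>1 = Gamma (2 * d) / pi * sin (pi * d) * r\<^sub>1"
    using sc by (simp add: field_simps)
  have "r\<^sub>0 = (Gamma d)\<^sup>2 / Gamma (2 * d) * ((a\<^sub>0\<^sup>2 + a\<^sub>1\<^sup>2) * (1 / cos (pi * d)) + (a\<^sub>0\<^sup>2 - a\<^sub>1\<^sup>2))"
    unfolding r0 P_def B_def Beta_one_minus_double[OF d] Beta_self_eq[OF d(1)] by (simp only: distrib_left distrib_right mult_ac)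
  moreover have "r\<^sub>1 = - 2 * a\<^sub>0 * a\<^sub>1 * ((Gamma d)\<^sup>2 / Gamma (2 * d))"
    unfolding r1 B_def Beta_self_eq[OF d(1)] ..
  ultimately show ?thesis using g0 g1 by blast
qed

end
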